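(* Let $\Omega\subset\mathbb{R}^3$ be an open bounded domain with Lipschitz-continuous boundary, let full Dirichlet boundary conditions be applied, and let $V_h\subset \mathcal{H}^{DC}_0(\Omega)$ be a finite-element space. Let $\mathbf{n}_k\in\mathcal{H}^{DC}(\Omega)$ be a finite-element function and let $0<\alpha\le 1\le\beta$ be constants such that $\alpha\le |\mathbf{n}_k|^2\le\beta$ on $\Omega$. Let $K_1\ge0$, $K_3>0$, $\zeta>0$ be fixed. (i) If $\kappa=1$ and $2\zeta|\alpha-1|<\alpha_0$, where $\alpha_0>0$ is the coercivity constant of $\hat a$ for $\kappa=1$ (so that $\alpha_0\|\mathbf{v}\|_{DC}^2\le\hat a(\mathbf{v},\mathbf{v})$ for all $\mathbf{v}\in V_h$), then the discrete variational problem $$\text{find }\mathbf{u}_h\in V_h\text{ such that } a(\mathbf{u}_h,\mathbf{v}_h)=F(\mathbf{v}_h)\quad\text{for all }\mathbf{v}_h\in V_h\qquad(\ast)$$ is well-posed. (ii) If $\beta_1=\frac{\min(K_1,K_3)}{C+1}-2\zeta|\alpha-1|>0$, where $C>0$ is a constant with $\|\mathbf{v}\|_0^2\le C\big(\|\nabla\cdot\mathbf{v}\|_0^2+\|\nabla\times\mathbf{v}\|_0^2\big)$ for all $\mathbf{v}\in\mathcal{H}^{DC}_0(\Omega)$, then there exist $\epsilon_1,\epsilon_2>0$, dependent on $\beta$, such that for every $K_2>0$ with $\kappa=K_2/K_3\in(1-\epsilon_2,1+\epsilon_1)$ for which $\mathbf{Z}(\mathbf{n}_k(\mathbf{x}))$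 is uniformly symmetric positive definite on $\Omega$ (with Rayleigh-quotient bounds $\eta,\Lambda$), the problem $(\ast)$ is well-posed.
   Context: $\langle\cdot,\cdot\rangle_0$ and $\|\cdot\|_0$ are the $L^2(\Omega)$ (or $L^2(\Omega)^3$) inner product and norm; $|\cdot|$ is the Euclidean norm (or absolute value). $H(\mathrm{div},\Omega)=\{\mathbf{v}\in L^2(\Omega)^3:\nabla\cdot\mathbf{v}\in L^2(\Omega)\}$ and $H(\mathrm{curl},\Omega)=\{\mathbf{v}\in L^2(\Omega)^3:\nabla\times\mathbf{v}\in L^2(\Omega)^3\}$. With full Dirichlet data $\mathbf{g}\in H^{1/2}(\partial\Omega)^3$, $\mathcal{H}^{DC}(\Omega)=\{\mathbf{v}\in H(\mathrm{div},\Omega)\cap H(\mathrm{curl},\Omega): \mathbf{v}=\mathbf{g}\text{ on }\partial\Omega\}$, and $\mathcal{H}^{DC}_0(\Omega)$ is the same space with $\mathbf{g}=\mathbf{0}$ (for a Lipschitz domain it equals $H^1_0(\Omega)^3$). The norm is $\|\mathbf{v}\|_{DC}^2=\|\mathbf{v}\|_0^2+\|\nabla\cdot\mathbf{v}\|_0^2+\|\nabla\times\mathbf{v}\|_0^2$. Finite-element functions are piecewise polynomial on a finite mesh of $\Omega$; $V_h$ is finite-dimensional, and $\mathbf{n}_k$, its curl and divergence, and the elements of $V_h$ and their curls and divergences are bounded functions. $K_1,K_2,K_3$ are the Frank constants ($K_2>0$), $\kappa=K_2/K_3$, and $\zeta$ is the penalty weight. $\mathbf{Z}(\mathbf{n})=\mathbf{I}-(1-\kappa)\,\mathbf{n}\otimes\mathbf{n}$.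 Uniformly symmetric positive definite with Rayleigh-quotient bounds $\eta,\Lambda$ means $0<\eta\le \frac{\xi^T\mathbf{Z}(\mathbf{n}_k(\mathbf{x}))\xi}{\xi^T\xi}\le\Lambda<\infty$ for all $\mathbf{x}\in\Omega$ and nonzero $\xi\in\mathbb{R}^3$ (automatic when $\kappa=1$, since then $\mathbf{Z}=\mathbf{I}$). The bilinear form is $$a(\mathbf{u},\mathbf{v})=\hat a(\mathbf{u},\mathbf{v})+2\zeta\big(\langle\mathbf{n}_k\cdot\mathbf{n}_k-1,\mathbf{v}\cdot\mathbf{u}\rangle_0+2\langle\mathbf{u}\cdot\mathbf{n}_k,\mathbf{v}\cdot\mathbf{n}_k\rangle_0\big),$$ where $$\hat a(\mathbf{u},\mathbf{v})=K_1\langle\nabla\cdot\mathbf{u},\nabla\cdot\mathbf{v}\rangle_0+K_3\langle\mathbf{Z}(\mathbf{n}_k)\nabla\times\mathbf{u},\nabla\times\mathbf{v}\rangle_0+(K_2-K_3)\Big(\langle\mathbf{u}\cdot\nabla\times\mathbf{v},\mathbf{n}_k\cdot\nabla\times\mathbf{n}_k\rangle_0+\langle\mathbf{n}_k\cdot\nabla\times\mathbf{v},\mathbf{u}\cdot\nabla\times\mathbf{n}_k\rangle_0+\langle\mathbf{n}_k\cdot\nabla\times\mathbf{n}_k,\mathbf{v}\cdot\nabla\times\mathbf{u}\rangle_0+\langle\mathbf{n}_k\cdot\nabla\times\mathbf{u},\mathbf{v}\cdot\nabla\times\mathbf{n}_k\rangle_0+\langle\mathbf{u}\cdot\nabla\times\mathbf{n}_k,\mathbf{v}\cdot\nabla\times\mathbf{n}_k\rangle_0\Big).$$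 The linear functional is $$F(\mathbf{v})=-\Big(K_1\langle\nabla\cdot\mathbf{n}_k,\nabla\cdot\mathbf{v}\rangle_0+K_3\langle\mathbf{Z}(\mathbf{n}_k)\nabla\times\mathbf{n}_k,\nabla\times\mathbf{v}\rangle_0+(K_2-K_3)\langle\mathbf{n}_k\cdot\nabla\times\mathbf{n}_k,\mathbf{v}\cdot\nabla\times\mathbf{n}_k\rangle_0+2\zeta\langle\mathbf{v}\cdot\mathbf{n}_k,\mathbf{n}_k\cdot\mathbf{n}_k-1\rangle_0\Big).$$ Problem $(\ast)$ is the discretized Newton linearization at $\mathbf{n}_k$ (common factor $2$ removed) of the first-order optimality condition for the penalty functional $\mathcal{P}(\mathbf{n})=K_1\|\nabla\cdot\mathbf{n}\|_0^2+K_3\langle\mathbf{Z}(\mathbf{n})\nabla\times\mathbf{n},\nabla\times\mathbf{n}\rangle_0+\zeta\langle\mathbf{n}\cdot\mathbf{n}-1,\mathbf{n}\cdot\mathbf{n}-1\rangle_0$. Well-posed is meant in the Lax–Milgram sense: there is a unique solution $\mathbf{u}_h\in V_h$, and it depends continuously on the right-hand side, i.e. $\|\mathbf{u}_h\|_{DC}\le M\sup_{\mathbf{0}\ne\mathbf{v}\in V_h}|F(\mathbf{v})|/\|\mathbf{v}\|_{DC}$ with a finite constant $M$ depending only on the form $a$ on $V_h$. The constants $\epsilon_1,\epsilon_2$ are chosen for the fixed data $\Omega,V_h,\mathbf{n}_k,\alpha,\beta,K_1,K_3,\zeta,C$ and do not depend on $K_2$. *)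

theory Defs
  imports "HOL-Analysis.Analysis"
begin

text \<open>
  Scalar and vector fields on a domain are total functions on \<open>real^3\<close>; only their restriction
  to the domain matters, and elements of \<open>L\<^sup>2\<close> are represented by functions that are identified
  when they agree almost everywhere.
\<close>

section \<open>Smooth functions and classical derivatives\<close>

definition partial_deriv :: "3 \<Rightarrow> (real^3 \<Rightarrow> 'b::real_normed_vector) \<Rightarrow> real^3 \<Rightarrow> 'b" where
  "partial_deriv i f x = frechet_derivative f (at x) (axis i 1)"

primrec C_diff :: "nat \<Rightarrow> (real^3 \<Rightarrow> 'b::real_normed_vector) \<Rightarrow> bool" where
  "C_diff 0 f \<longleftrightarrow> continuous_on UNIV f"
| "C_diff (Suc k) f \<longleftrightarrow> (\<forall>x. f differentiable (at x)) \<and> (\<forall>i. C_diff k (partial_deriv i f))"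

definition smooth :: "(real^3 \<Rightarrow> 'b::real_normed_vector) \<Rightarrow> bool" where
  "smooth f \<longleftrightarrow> (\<forall>k. C_diff k f)"

definition test_functions :: "(real^3) set \<Rightarrow> (real^3 \<Rightarrow> 'b::real_normed_vector) set" where
  "test_functions \<Omega> =
     {\<phi>. smooth \<phi> \<and> compact (closure {x. \<phi> x \<noteq> 0}) \<and> closure {x. \<phi> x \<noteq> 0} \<subseteq> \<Omega>}"

definition grad :: "(real^3 \<Rightarrow> real) \<Rightarrow> real^3 \<Rightarrow> real^3" where
  "grad \<phi> x = (\<chi> i. partial_deriv i \<phi> x)"

definition curl :: "(real^3 \<Rightarrow> real^3) \<Rightarrow> real^3 \<Rightarrow> real^3" where
  "curl \<phi> x = vector
     [partial_deriv 2 \<phi> x $ 3 - partial_deriv 3 \<phi> x $ 2,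
      partial_deriv 3 \<phi> x $ 1 - partial_deriv 1 \<phi> x $ 3,
      partial_deriv 1 \<phi> x $ 2 - partial_deriv 2 \<phi> x $ 1]"

section \<open>Square integrable functions and weak derivatives\<close>

definition L2_space :: "(real^3) set \<Rightarrow> (real^3 \<Rightarrow> 'b::euclidean_space) set" where
  "L2_space \<Omega> = {f. f \<in> borel_measurable (lebesgue_on \<Omega>) \<and>
                     integrable (lebesgue_on \<Omega>) (\<lambda>x. (norm (f x))\<^sup>2)}"

definition L2_inner ::
  "(real^3) set \<Rightarrow> (real^3 \<Rightarrow> 'b::euclidean_space) \<Rightarrow> (real^3 \<Rightarrow> 'b) \<Rightarrow> real" where
  "L2_inner \<Omega> f g = (\<integral>x. f x \<bullet> g x \<partial>lebesgue_on \<Omega>)"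

definition L2_norm :: "(real^3) set \<Rightarrow> (real^3 \<Rightarrow> 'b::euclidean_space) \<Rightarrow> real" where
  "L2_norm \<Omega> f = sqrt (L2_inner \<Omega> f f)"

definition ess_bounded :: "(real^3) set \<Rightarrow> (real^3 \<Rightarrow> 'b::euclidean_space) \<Rightarrow> bool" where
  "ess_bounded \<Omega> f \<longleftrightarrow> (\<exists>B. AE x in lebesgue_on \<Omega>. norm (f x) \<le> B)"

definition has_weak_div :: "(real^3) set \<Rightarrow> (real^3 \<Rightarrow> real^3) \<Rightarrow> (real^3 \<Rightarrow> real) \<Rightarrow> bool" where
  "has_weak_div \<Omega> v d \<longleftrightarrow> d \<in> L2_space \<Omega> \<and>
     (\<forall>\<phi>\<in>test_functions \<Omega>. L2_inner \<Omega> v (grad \<phi>) = - L2_inner \<Omega> d \<phi>)"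

definition has_weak_curl ::
  "(real^3) set \<Rightarrow> (real^3 \<Rightarrow> real^3) \<Rightarrow> (real^3 \<Rightarrow> real^3) \<Rightarrow> bool" where
  "has_weak_curl \<Omega> v c \<longleftrightarrow> c \<in> L2_space \<Omega> \<and>
     (\<forall>\<phi>\<in>test_functions \<Omega>. L2_inner \<Omega> v (curl \<phi>) = L2_inner \<Omega> c \<phi>)"

definition has_weak_partial ::
  "(real^3) set \<Rightarrow> 3 \<Rightarrow> (real^3 \<Rightarrow> real^3) \<Rightarrow> (real^3 \<Rightarrow> real^3) \<Rightarrow> bool" where
  "has_weak_partial \<Omega> i v d \<longleftrightarrow> d \<in> L2_space \<Omega> \<and>
     (\<forall>\<phi>\<in>test_functions \<Omega>. L2_inner \<Omega> v (partial_deriv i \<phi>) = - L2_inner \<Omega> d \<phi>)"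

text \<open>
  On an open set weak derivatives are unique up to a null set, so the choice below is immaterial.
\<close>

definition wdiv :: "(real^3) set \<Rightarrow> (real^3 \<Rightarrow> real^3) \<Rightarrow> real^3 \<Rightarrow> real" where
  "wdiv \<Omega> v = (SOME d. has_weak_div \<Omega> v d)"

definition wcurl :: "(real^3) set \<Rightarrow> (real^3 \<Rightarrow> real^3) \<Rightarrow> real^3 \<Rightarrow> real^3" where
  "wcurl \<Omega> v = (SOME c. has_weak_curl \<Omega> v c)"

definition wpartial :: "(real^3) set \<Rightarrow> 3 \<Rightarrow> (real^3 \<Rightarrow> real^3) \<Rightarrow> real^3 \<Rightarrow> real^3" where
  "wpartial \<Omega> i v = (SOME d. has_weak_partial \<Omega> i v d)"

definition H_div :: "(real^3) set \<Rightarrow> (real^3 \<Rightarrow> real^3) set" where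
  "H_div \<Omega> = {v \<in> L2_space \<Omega>. \<exists>d. has_weak_div \<Omega> v d}"

definition H_curl :: "(real^3) set \<Rightarrow> (real^3 \<Rightarrow> real^3) set" where
  "H_curl \<Omega> = {v \<in> L2_space \<Omega>. \<exists>c. has_weak_curl \<Omega> v c}"

definition H1 :: "(real^3) set \<Rightarrow> (real^3 \<Rightarrow> real^3) set" where
  "H1 \<Omega> = {v \<in> L2_space \<Omega>. \<forall>i. \<exists>d. has_weak_partial \<Omega> i v d}"

definition H1_norm :: "(real^3) set \<Rightarrow> (real^3 \<Rightarrow> real^3) \<Rightarrow> real" where
  "H1_norm \<Omega> v = sqrt ((L2_norm \<Omega> v)\<^sup>2 + (\<Sum>i\<in>UNIV. (L2_norm \<Omega> (wpartial \<Omega> i v))\<^sup>2))"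

definition DC_norm :: "(real^3) set \<Rightarrow> (real^3 \<Rightarrow> real^3) \<Rightarrow> real" where
  "DC_norm \<Omega> v =
     sqrt ((L2_norm \<Omega> v)\<^sup>2 + (L2_norm \<Omega> (wdiv \<Omega> v))\<^sup>2 + (L2_norm \<Omega> (wcurl \<Omega> v))\<^sup>2)"

section \<open>Lipschitz domains\<close>

text \<open>
  Near each boundary point, after a rotation that takes a unit vector \<open>e\<close> to the vertical
  direction, the domain is the part of a neighbourhood that lies above the graph of a Lipschitz
  function \<open>\<psi>\<close> on the plane orthogonal to \<open>e\<close>.
\<close>

definition lipschitz_boundary :: "(real^3) set \<Rightarrow> bool" where
  "lipschitz_boundary \<Omega> \<longleftrightarrow> (\<forall>p\<in>frontier \<Omega>. \<exists>U e \<psi> L.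
     open U \<and> p \<in> U \<and> norm e = 1 \<and> L-lipschitz_on {y. y \<bullet> e = 0} \<psi> \<and>
     \<Omega> \<inter> U = {x \<in> U. x \<bullet> e > \<psi> (x - (x \<bullet> e) *\<^sub>R e)})"

definition lipschitz_domain :: "(real^3) set \<Rightarrow> bool" where
  "lipschitz_domain \<Omega> \<longleftrightarrow>
     open \<Omega> \<and> connected \<Omega> \<and> bounded \<Omega> \<and> \<Omega> \<noteq> {} \<and> lipschitz_boundary \<Omega>"

section \<open>Boundary values\<close>

text \<open>
  Surface measure is the two-dimensional Hausdorff measure, normalised to agree with area on planes.
\<close>

definition hausdorff2_delta :: "real \<Rightarrow> (real^3) set \<Rightarrow> ennreal" where
  "hausdorff2_delta \<delta> A =
     (INF C\<in>{C :: nat \<Rightarrow> (real^3) set. A \<subseteq> (\<Union>n. C n) \<and> (\<forall>n. bounded (C n) \<and> diameter (C n) \<le> \<delta>)}.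
        \<Sum>n. ennreal (pi / 4 * (diameter (C n))\<^sup>2))"

definition surface_measure :: "(real^3) measure" where
  "surface_measure = measure_of UNIV (sets borel) (\<lambda>A. SUP \<delta>\<in>{0<..}. hausdorff2_delta \<delta> A)"

text \<open>
  \<open>has_trace \<Omega> v g\<close>: \<open>g\<close> is the trace of \<open>v \<in> H\<^sup>1(\<Omega>)\<^sup>3\<close>, i.e. the image of \<open>v\<close> under the continuous
  extension to \<open>H\<^sup>1(\<Omega>)\<^sup>3\<close> of the restriction of smooth fields to the boundary.
\<close>

definition has_trace :: "(real^3) set \<Rightarrow> (real^3 \<Rightarrow> real^3) \<Rightarrow> (real^3 \<Rightarrow> real^3) \<Rightarrow> bool" where
  "has_trace \<Omega> v g \<longleftrightarrow>
     g \<in> borel_measurable (restrict_space borel (frontier \<Omega>)) \<and>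
     (\<exists>\<Phi>. (\<forall>j::nat. smooth (\<Phi> j)) \<and>
        (\<lambda>j. H1_norm \<Omega> (\<lambda>x. \<Phi> j x - v x)) \<longlonglongrightarrow> 0 \<and>
        (\<lambda>j. \<integral>\<^sup>+x\<in>frontier \<Omega>. ennreal ((norm (\<Phi> j x - g x))\<^sup>2) \<partial>surface_measure) \<longlonglongrightarrow> 0)"

text \<open>\<open>H\<^sup>1\<^sup>/\<^sup>2(\<partial>\<Omega>)\<^sup>3\<close> is the trace space of \<open>H\<^sup>1(\<Omega>)\<^sup>3\<close>.\<close>

definition H_half :: "(real^3) set \<Rightarrow> (real^3 \<Rightarrow> real^3) set" where
  "H_half \<Omega> = {g. \<exists>v\<in>H1 \<Omega>. has_trace \<Omega> v g}"

text \<open>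
  Vanishing of the normal and of the tangential trace, both of which are defined on
  \<open>H(div,\<Omega>) \<inter> H(curl,\<Omega>)\<close> by Green's formulas, the boundary terms of which are the pairings of
  \<open>v \<cdot> \<nu>\<close> and \<open>\<nu> \<times> v\<close> with \<open>\<phi>\<close>.
\<close>

definition zero_trace :: "(real^3) set \<Rightarrow> (real^3 \<Rightarrow> real^3) \<Rightarrow> bool" where
  "zero_trace \<Omega> v \<longleftrightarrow>
     (\<forall>\<phi>. smooth \<phi> \<longrightarrow> L2_inner \<Omega> (wdiv \<Omega> v) \<phi> + L2_inner \<Omega> v (grad \<phi>) = 0) \<and>
     (\<forall>\<phi>. smooth \<phi> \<longrightarrow> L2_inner \<Omega> (wcurl \<Omega> v) \<phi> - L2_inner \<Omega> v (curl \<phi>) = 0)"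

text \<open>
  A field in \<open>H(div,\<Omega>) \<inter> H(curl,\<Omega>)\<close> only has a normal and a tangential trace, so it is compared
  with the datum \<open>g\<close> through an \<open>H\<^sup>1\<close> lifting \<open>w\<close> of \<open>g\<close>.
\<close>

definition boundary_values :: "(real^3) set \<Rightarrow> (real^3 \<Rightarrow> real^3) \<Rightarrow> (real^3 \<Rightarrow> real^3) \<Rightarrow> bool" where
  "boundary_values \<Omega> v g \<longleftrightarrow>
     (\<exists>w\<in>H1 \<Omega>. has_trace \<Omega> w g \<and> zero_trace \<Omega> (\<lambda>x. v x - w x))"

definition H_DC :: "(real^3) set \<Rightarrow> (real^3 \<Rightarrow> real^3) \<Rightarrow> (real^3 \<Rightarrow> real^3) set" where
  "H_DC \<Omega> g = {v \<in> H_div \<Omega> \<inter> H_curl \<Omega>. boundary_values \<Omega> v g}"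

definition H_DC0 :: "(real^3) set \<Rightarrow> (real^3 \<Rightarrow> real^3) set" where
  "H_DC0 \<Omega> = H_DC \<Omega> (\<lambda>x. 0)"

section \<open>Finite elements\<close>

text \<open>
  A mesh is given by the interiors of its cells, which may be curved. Finite-element functions are
  unconstrained on the interfaces, a null set. For fields in \<open>H(div,\<Omega>) \<inter> H(curl,\<Omega>)\<close> the bounds in
  \<open>fe_function_on\<close> restrict nothing: a polynomial and its derivatives are bounded on each cell.
\<close>

definition mesh :: "(real^3) set \<Rightarrow> (real^3) set set \<Rightarrow> bool" where
  "mesh \<Omega> \<T> \<longleftrightarrow> finite \<T> \<and> (\<forall>K\<in>\<T>. lipschitz_domain K) \<and> pairwise disjnt \<T> \<and>
     (\<Union>K\<in>\<T>. closure K) = closure \<Omega>"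

definition fe_function_on ::
  "(real^3) set \<Rightarrow> (real^3) set set \<Rightarrow> (real^3 \<Rightarrow> real^3) \<Rightarrow> bool" where
  "fe_function_on \<Omega> \<T> v \<longleftrightarrow>
     (\<forall>K\<in>\<T>. \<exists>p. polynomial_function p \<and> (\<forall>x\<in>K. v x = p x)) \<and>
     ess_bounded \<Omega> v \<and> ess_bounded \<Omega> (wdiv \<Omega> v) \<and> ess_bounded \<Omega> (wcurl \<Omega> v)"

definition fe_function :: "(real^3) set \<Rightarrow> (real^3 \<Rightarrow> real^3) \<Rightarrow> bool" where
  "fe_function \<Omega> v \<longleftrightarrow> (\<exists>\<T>. mesh \<Omega> \<T> \<and> fe_function_on \<Omega> \<T> v)"

definition finite_dim_space :: "(real^3 \<Rightarrow> real^3) set \<Rightarrow> bool" where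
  "finite_dim_space V \<longleftrightarrow>
     (\<exists>(m::nat) b. V = {\<lambda>x. \<Sum>i<m. c i *\<^sub>R b i x | c. c \<in> (UNIV :: (nat \<Rightarrow> real) set)})"

definition fe_space :: "(real^3) set \<Rightarrow> (real^3 \<Rightarrow> real^3) set \<Rightarrow> bool" where
  "fe_space \<Omega> V \<longleftrightarrow> finite_dim_space V \<and> (\<exists>\<T>. mesh \<Omega> \<T> \<and> (\<forall>v\<in>V. fe_function_on \<Omega> \<T> v))"

section \<open>The linearised problem\<close>

definition Z_mat :: "real \<Rightarrow> real^3 \<Rightarrow> real^3^3" where
  "Z_mat \<kappa> n = mat 1 - (1 - \<kappa>) *\<^sub>R (\<chi> i j. n $ i * n $ j)"

definition uniformly_spd :: "(real^3) set \<Rightarrow> (real^3 \<Rightarrow> real^3^3) \<Rightarrow> bool" where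
  "uniformly_spd \<Omega> A \<longleftrightarrow> (\<forall>x\<in>\<Omega>. transpose (A x) = A x) \<and>
     (\<exists>\<eta> \<Lambda>. 0 < \<eta> \<and> (\<forall>x\<in>\<Omega>. \<forall>\<xi>. \<xi> \<noteq> 0 \<longrightarrow>
        \<eta> \<le> (\<xi> \<bullet> (A x *v \<xi>)) / (\<xi> \<bullet> \<xi>) \<and> (\<xi> \<bullet> (A x *v \<xi>)) / (\<xi> \<bullet> \<xi>) \<le> \<Lambda>))"

definition a_hat ::
  "(real^3) set \<Rightarrow> real \<Rightarrow> real \<Rightarrow> real \<Rightarrow> (real^3 \<Rightarrow> real^3) \<Rightarrow>
   (real^3 \<Rightarrow> real^3) \<Rightarrow> (real^3 \<Rightarrow> real^3) \<Rightarrow> real" where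
  "a_hat \<Omega> K1 K2 K3 n u v =
     K1 * L2_inner \<Omega> (wdiv \<Omega> u) (wdiv \<Omega> v)
   + K3 * L2_inner \<Omega> (\<lambda>x. Z_mat (K2 / K3) (n x) *v wcurl \<Omega> u x) (wcurl \<Omega> v)
   + (K2 - K3) *
     (L2_inner \<Omega> (\<lambda>x. u x \<bullet> wcurl \<Omega> v x) (\<lambda>x. n x \<bullet> wcurl \<Omega> n x)
    + L2_inner \<Omega> (\<lambda>x. n x \<bullet> wcurl \<Omega> v x) (\<lambda>x. u x \<bullet> wcurl \<Omega> n x)
    + L2_inner \<Omega> (\<lambda>x. n x \<bullet> wcurl \<Omega> n x) (\<lambda>x. v x \<bullet> wcurl \<Omega> u x)
    + L2_inner \<Omega> (\<lambda>x. n x \<bullet> wcurl \<Omega> u x) (\<lambda>x. v x \<bullet> wcurl \<Omega> n x)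
    + L2_inner \<Omega> (\<lambda>x. u x \<bullet> wcurl \<Omega> n x) (\<lambda>x. v x \<bullet> wcurl \<Omega> n x))"

definition a_form ::
  "(real^3) set \<Rightarrow> real \<Rightarrow> real \<Rightarrow> real \<Rightarrow> real \<Rightarrow> (real^3 \<Rightarrow> real^3) \<Rightarrow>
   (real^3 \<Rightarrow> real^3) \<Rightarrow> (real^3 \<Rightarrow> real^3) \<Rightarrow> real" where
  "a_form \<Omega> K1 K2 K3 \<zeta> n u v = a_hat \<Omega> K1 K2 K3 n u v
   + 2 * \<zeta> * (L2_inner \<Omega> (\<lambda>x. n x \<bullet> n x - 1) (\<lambda>x. v x \<bullet> u x)
            + 2 * L2_inner \<Omega> (\<lambda>x. u x \<bullet> n x) (\<lambda>x. v x \<bullet> n x))"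

definition F_form ::
  "(real^3) set \<Rightarrow> real \<Rightarrow> real \<Rightarrow> real \<Rightarrow> real \<Rightarrow> (real^3 \<Rightarrow> real^3) \<Rightarrow> (real^3 \<Rightarrow> real^3) \<Rightarrow> real" where
  "F_form \<Omega> K1 K2 K3 \<zeta> n v =
   - (K1 * L2_inner \<Omega> (wdiv \<Omega> n) (wdiv \<Omega> v)
    + K3 * L2_inner \<Omega> (\<lambda>x. Z_mat (K2 / K3) (n x) *v wcurl \<Omega> n x) (wcurl \<Omega> v)
    + (K2 - K3) * L2_inner \<Omega> (\<lambda>x. n x \<bullet> wcurl \<Omega> n x) (\<lambda>x. v x \<bullet> wcurl \<Omega> n x)
    + 2 * \<zeta> * L2_inner \<Omega> (\<lambda>x. v x \<bullet> n x) (\<lambda>x. n x \<bullet> n x - 1))"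

section \<open>Well-posedness\<close>

definition solution ::
  "(real^3 \<Rightarrow> real^3) set \<Rightarrow> ((real^3 \<Rightarrow> real^3) \<Rightarrow> (real^3 \<Rightarrow> real^3) \<Rightarrow> real) \<Rightarrow>
   ((real^3 \<Rightarrow> real^3) \<Rightarrow> real) \<Rightarrow> (real^3 \<Rightarrow> real^3) \<Rightarrow> bool" where
  "solution V a G u \<longleftrightarrow> u \<in> V \<and> (\<forall>v\<in>V. a u v = G v)"

definition DC_functional ::
  "(real^3) set \<Rightarrow> (real^3 \<Rightarrow> real^3) set \<Rightarrow> ((real^3 \<Rightarrow> real^3) \<Rightarrow> real) \<Rightarrow> bool" where
  "DC_functional \<Omega> V G \<longleftrightarrow>
     (\<forall>u\<in>V. \<forall>v\<in>V. G (\<lambda>x. u x + v x) = G u + G v) \<and>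
     (\<forall>c. \<forall>v\<in>V. G (\<lambda>x. c *\<^sub>R v x) = c * G v) \<and>
     (\<exists>B. \<forall>v\<in>V. \<bar>G v\<bar> \<le> B * DC_norm \<Omega> v)"

text \<open>Inserting \<open>0\<close> makes the supremum \<open>0\<close> when \<open>V\<close> is the zero space.\<close>

definition dual_norm ::
  "(real^3) set \<Rightarrow> (real^3 \<Rightarrow> real^3) set \<Rightarrow> ((real^3 \<Rightarrow> real^3) \<Rightarrow> real) \<Rightarrow> real" where
  "dual_norm \<Omega> V G = Sup (insert 0
     {\<bar>G v\<bar> / DC_norm \<Omega> v | v. v \<in> V \<and> \<not> (AE x in lebesgue_on \<Omega>. v x = 0)})"

text \<open>
  The stability constant \<open>M\<close> depends on \<open>V\<close> and \<open>a\<close> only; this is expressed by letting the same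
  \<open>M\<close> serve every right-hand side \<open>G\<close>, among them \<open>F\<close>.
\<close>

definition well_posed ::
  "(real^3) set \<Rightarrow> (real^3 \<Rightarrow> real^3) set \<Rightarrow>
   ((real^3 \<Rightarrow> real^3) \<Rightarrow> (real^3 \<Rightarrow> real^3) \<Rightarrow> real) \<Rightarrow> ((real^3 \<Rightarrow> real^3) \<Rightarrow> real) \<Rightarrow> bool" where
  "well_posed \<Omega> V a F \<longleftrightarrow>
     DC_functional \<Omega> V F \<and>
     (\<exists>u. solution V a F u \<and>
        (\<forall>w. solution V a F w \<longrightarrow> (AE x in lebesgue_on \<Omega>. w x = u x))) \<and>
     (\<exists>M. \<forall>G u. DC_functional \<Omega> V G \<longrightarrow> solution V a G u \<longrightarrow>
        DC_norm \<Omega> u \<le> M * dual_norm \<Omega> V G)"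

end

theory Submission
  imports Defs
begin

text \<open>
  Lax--Milgram on a finite-dimensional space: the forms only have to be well defined and \<open>a\<close>
  coercive. Coercivity is an estimate of two perturbations. The penalty part of \<open>a\<close> is bounded
  below by \<open>- 2 \<zeta> \<bar>\<alpha> - 1\<bar> \<parallel>v\<parallel>\<^sup>2\<close>, because \<open>n \<cdot> n - 1 \<ge> \<alpha> - 1\<close> and the remaining term is a square
  (\<open>a_form_ge_a_hat\<close>); this gives the case \<open>\<kappa> = 1\<close>, where \<open>\<hat>a\<close> is coercive by hypothesis. For
  \<open>\<kappa>\<close> near \<open>1\<close>, everything in \<open>\<hat>a(v, v)\<close> beyond \<open>K\<^sub>1 \<parallel>div v\<parallel>\<^sup>2 + K\<^sub>3 \<parallel>curl v\<parallel>\<^sup>2\<close>, including the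
  deviation of \<open>Z\<close> from the identity, carries the factor \<open>K\<^sub>2 - K\<^sub>3 = K\<^sub>3 (\<kappa> - 1)\<close>. Its cofactor
  is a quadratic form in \<open>v\<close> and \<open>curl v\<close> with coefficients bounded in terms of \<open>n\<close> and
  \<open>curl n\<close> (\<open>a_hat_lower_bound\<close>), so a small \<open>\<bar>\<kappa> - 1\<bar>\<close> uses up only a part of the margin
  \<open>\<beta>\<^sub>1\<close> that the Poincare inequality leaves.

  That the forms are well defined is less immediate than it looks. Divergence and curl are chosen
  representatives of weak derivatives, so even the linearity of \<open>v \<mapsto> div v\<close> holds only almost
  everywhere, and only because weak derivatives are unique. Uniqueness is the fundamental lemma of
  the calculus of variations (\<open>AE_zero_if_test_integrals_zero\<close>), for which smooth bump functions
  are built from \<open>exp (- 1 / t)\<close>.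

  From there on a field \<open>v\<close> is replaced by its jet \<open>(v, div v, curl v)\<close>. The norm of the problem
  is the \<open>L\<^sup>2\<close> norm of the jet, \<open>a(u, v)\<close> is the \<open>L\<^sup>2\<close> pairing of the jet of \<open>v\<close> with a field
  \<open>flux\<close> depending on the jet of \<open>u\<close>, and \<open>F(v)\<close> is its pairing with a fixed field
  \<open>residual\<close>. Boundedness of finite-element functions puts both fields in \<open>L\<^sup>2\<close>, and any such
  pairing is linear and bounded in the test function \<open>v\<close>. Linearity of \<open>a\<close> in \<open>u\<close> follows by
  symmetry.

  The spanning fields of the finite-element space need not be linearly independent, not even
  modulo null sets, so the stiffness matrix may be singular. The system is still solvable, since
  vectors in the kernel of the matrix represent null fields, which \<open>a\<close> and \<open>F\<close> annihilate
  (\<open>semidefinite_system_solvable\<close>, \<open>coercive_problem_well_posed\<close>).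
\<close>

section \<open>Smooth bump functions\<close>

lemma partial_deriv_eqI:
  assumes "\<And>x. (f has_derivative f' x) (at x)"
  shows "partial_deriv i f = (\<lambda>x. f' x (axis i 1))"
  unfolding partial_deriv_def using frechet_derivative_at[OF assms] by metis

lemma C_diff_SucI:
  assumes "\<And>x. (f has_derivative f' x) (at x)" and "\<And>i. C_diff k (\<lambda>x. f' x (axis i 1))"
  shows "C_diff (Suc k) f"
proof -
  have "f differentiable (at x)" for x using assms(1) by (rule differentiableI)
  then show ?thesis using assms(2) partial_deriv_eqI[OF assms(1)] by simp
qed

lemma C_diff_Suc_has_derivative:
  assumes "C_diff (Suc k) f"
  shows "(f has_derivative frechet_derivative f (at x)) (at x)"
  using assms by (simp add: frechet_derivative_works)

lemma C_diff_Suc_partial: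
  assumes "C_diff (Suc k) f"
  shows "C_diff k (\<lambda>x. frechet_derivative f (at x) (axis i 1))"
  using assms by (simp add: partial_deriv_def[abs_def])

lemma C_diff_lower: "C_diff (Suc k) f \<Longrightarrow> C_diff k f"
proof (induction k arbitrary: f)
  case 0
  then show ?case
    by (simp add: continuous_on_eq_continuous_within differentiable_imp_continuous_within)
next
  case (Suc k)
  then have "\<forall>x. f differentiable (at x)" and "\<forall>i. C_diff (Suc k) (partial_deriv i f)"
    by (auto simp only: C_diff.simps(2))
  with Suc.IH show ?case by simp
qed

lemma C_diff_add: "C_diff k f \<Longrightarrow> C_diff k g \<Longrightarrow> C_diff k (\<lambda>x. f x + g x)"
proof (induction k arbitrary: f g)
  case (Suc k)
  note D = C_diff_Suc_has_derivative[OF Suc.prems(1)] C_diff_Suc_has_derivative[OF Suc.prems(2)]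
  show ?case
    by (rule C_diff_SucI[OF has_derivative_add[OF D]])
       (intro Suc.IH C_diff_Suc_partial[OF Suc.prems(1)] C_diff_Suc_partial[OF Suc.prems(2)])
qed (simp add: continuous_on_add)

lemma C_diff_mult:
  fixes f g :: "real^3 \<Rightarrow> real"
  shows "C_diff k f \<Longrightarrow> C_diff k g \<Longrightarrow> C_diff k (\<lambda>x. f x * g x)"
proof (induction k arbitrary: f g)
  case (Suc k)
  note D = C_diff_Suc_has_derivative[OF Suc.prems(1)] C_diff_Suc_has_derivative[OF Suc.prems(2)]
  show ?case
    by (rule C_diff_SucI[OF has_derivative_mult[OF D]])
       (intro C_diff_add Suc.IH C_diff_Suc_partial[OF Suc.prems(1)]
          C_diff_Suc_partial[OF Suc.prems(2)] C_diff_lower[OF Suc.prems(1)]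
          C_diff_lower[OF Suc.prems(2)])
qed (simp add: continuous_on_mult)

lemma C_diff_const: "C_diff k (\<lambda>x. c)"
proof (induction k arbitrary: c)
  case (Suc k)
  show ?case by (rule C_diff_SucI[OF has_derivative_const]) (rule Suc.IH)
qed simp

lemma C_diff_scaleR_right:
  fixes f :: "real^3 \<Rightarrow> real"
  shows "C_diff k f \<Longrightarrow> C_diff k (\<lambda>x. f x *\<^sub>R e)"
proof (induction k arbitrary: f)
  case (Suc k)
  show ?case
    by (rule C_diff_SucI[OF has_derivative_scaleR_left[OF C_diff_Suc_has_derivative[OF Suc.prems]]])
       (intro Suc.IH C_diff_Suc_partial[OF Suc.prems])
qed (simp add: continuous_on_scaleR continuous_on_const)

lemma C_diff_prod:
  fixes f :: "'i \<Rightarrow> real^3 \<Rightarrow> real"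
  shows "(\<And>i. i \<in> I \<Longrightarrow> C_diff k (f i)) \<Longrightarrow> C_diff k (\<lambda>x. \<Prod>i\<in>I. f i x)"
  by (induction I rule: infinite_finite_induct) (auto intro: C_diff_const C_diff_mult)

text \<open>
  The functions \<open>flat_exp p\<close> contain the standard flat function \<open>exp (- 1 / t)\<close> and, because
  differentiation only changes the polynomial \<open>p\<close>, all its derivatives. This makes smoothness an
  induction over one family.
\<close>

definition flat_exp :: "real poly \<Rightarrow> real \<Rightarrow> real" where
  "flat_exp p t = (if t > 0 then poly p (1 / t) * exp (- (1 / t)) else 0)"

definition flat_exp_deriv :: "real poly \<Rightarrow> real poly" where
  "flat_exp_deriv p = [:0, 0, 1:] * (p - pderiv p)"


lemma poly_over_exp_at_top: "((\<lambda>y::real. poly p y * exp (- y)) \<longlongrightarrow> 0) at_top"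
proof -
  have "((\<lambda>y::real. \<Sum>i\<le>degree p. coeff p i * (y ^ i / exp y)) \<longlongrightarrow> (\<Sum>i\<le>degree p. coeff p i * 0)) at_top"
    by (intro tendsto_sum tendsto_mult tendsto_const tendsto_power_div_exp_0)
  then show ?thesis
    by (simp add: poly_altdef sum_distrib_right exp_minus divide_inverse mult.assoc)
qed

text \<open>Substituting \<open>y = 1 / t\<close> turns flatness at \<open>0\<close> into exponential decay at infinity.\<close>

lemma flat_exp_tendsto_0: "(flat_exp p \<longlongrightarrow> 0) (at 0)"
proof -
  have "((\<lambda>t. poly p (inverse t) * exp (- inverse t)) \<longlongrightarrow> 0) (at_right 0)"
    by (rule filterlim_compose[OF poly_over_exp_at_top filterlim_inverse_at_top_right])
  then have "(flat_exp p \<longlongrightarrow> 0) (at_right 0)"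
    by (rule Lim_transform_eventually)
       (auto simp: flat_exp_def eventually_at_filter inverse_eq_divide)
  moreover have "(flat_exp p \<longlongrightarrow> 0) (at_left 0)"
    by (rule Lim_transform_eventually[OF tendsto_const])
       (auto simp: flat_exp_def eventually_at_filter)
  ultimately show ?thesis by (simp add: filterlim_at_split)
qed

lemma flat_exp_has_derivative:
  "(flat_exp p has_field_derivative flat_exp (flat_exp_deriv p) t) (at t)"
proof (cases "t = 0")
  case True
  \<comment> \<open>Dividing by \<open>t\<close> raises the degree of the polynomial by one, so the difference quotient at
    the flat point is again a member of the family.\<close>
  have "flat_exp (pCons 0 p) \<midarrow>0\<rightarrow> 0" by (rule flat_exp_tendsto_0)
  then have "(\<lambda>h. (flat_exp p (0 + h) - flat_exp p 0) / h) \<midarrow>0\<rightarrow> 0"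
    by (rule Lim_transform_eventually) (auto simp: flat_exp_def eventually_at_filter)
  then show ?thesis using True by (simp add: DERIV_def flat_exp_def)
next
  case False
  show ?thesis
  proof (cases "t > 0")
    case True
    have "((\<lambda>t. poly p (1 / t) * exp (- (1 / t))) has_field_derivative
        flat_exp (flat_exp_deriv p) t) (at t)"
      using True
      by (auto intro!: derivative_eq_intros simp: flat_exp_def flat_exp_deriv_def
          power2_eq_square field_simps)
    moreover have "\<forall>\<^sub>F s in nhds t. flat_exp p s = poly p (1 / s) * exp (- (1 / s))"
      by (rule eventually_nhds_in_open[of "{0<..}", THEN eventually_mono])
         (use True in \<open>auto simp: flat_exp_def\<close>)
    ultimately show ?thesis by (subst DERIV_cong_ev) auto
  next
    case neg: False
    have "\<forall>\<^sub>F s in nhds t. flat_exp p s = 0"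
      by (rule eventually_nhds_in_open[of "{..<0}", THEN eventually_mono])
         (use neg False in \<open>auto simp: flat_exp_def\<close>)
    moreover have "flat_exp (flat_exp_deriv p) t = 0" using neg by (simp add: flat_exp_def)
    ultimately show ?thesis by (subst DERIV_cong_ev) auto
  qed
qed

lemma C_diff_flat_exp: "C_diff k (\<lambda>x. flat_exp p (m * x $ i + c))"
proof (induction k arbitrary: p)
  case 0
  have "continuous_on UNIV (flat_exp p)"
    using flat_exp_has_derivative by (meson DERIV_continuous_on has_field_derivative_at_within)
  then have "continuous_on UNIV (\<lambda>x. flat_exp p (m * x $ i + c))"
    by (rule continuous_on_compose2) (auto intro!: continuous_intros)
  then show ?case by simp
next
  case (Suc k)
  have D: "((\<lambda>x. flat_exp p (m * x $ i + c)) has_derivative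
      (\<lambda>v. (m * v $ i) * flat_exp (flat_exp_deriv p) (m * x $ i + c))) (at x)" for x :: "real^3"
  proof -
    have "((\<lambda>x::real^3. m * x $ i + c) has_derivative (\<lambda>v. m * v $ i)) (at x)"
      by (auto intro!: derivative_eq_intros bounded_linear.has_derivative[OF bounded_linear_vec_nth])
    from has_derivative_compose[OF this flat_exp_has_derivative[unfolded has_field_derivative_def]]
    show ?thesis by (simp add: mult.commute)
  qed
  show ?case
    by (rule C_diff_SucI[OF D]) (intro C_diff_mult C_diff_const Suc.IH)
qed

text \<open>
  A smooth function positive exactly on \<open>box a b\<close>; as \<open>k\<close> grows it increases to the indicator
  function of the box.
\<close>

definition box_bump :: "real^3 \<Rightarrow> real^3 \<Rightarrow> nat \<Rightarrow> real^3 \<Rightarrow> real" where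
  "box_bump a b k x = (\<Prod>i\<in>UNIV. flat_exp 1 (real (Suc k) * x $ i + - real (Suc k) * a $ i) *
     flat_exp 1 (- real (Suc k) * x $ i + real (Suc k) * b $ i))"

lemma box_bump_smooth: "smooth (box_bump a b k)"
  unfolding smooth_def box_bump_def[abs_def]
  by (intro allI C_diff_prod C_diff_mult C_diff_flat_exp)

lemma flat_exp_1_bounds: "0 \<le> flat_exp 1 t" "flat_exp 1 t \<le> 1"
  by (auto simp: flat_exp_def)

lemma box_bump_bounds: "0 \<le> box_bump a b k x" "box_bump a b k x \<le> 1"
  unfolding box_bump_def
  by (intro prod_nonneg prod_le_1 ballI conjI mult_nonneg_nonneg mult_le_one flat_exp_1_bounds)+

lemma flat_exp_scaled:
  "flat_exp 1 (real (Suc k) * s + - real (Suc k) * c) = flat_exp 1 (real (Suc k) * (s - c))"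
  "flat_exp 1 (- real (Suc k) * s + real (Suc k) * c) = flat_exp 1 (real (Suc k) * (c - s))"
  by (simp_all add: algebra_simps)

lemma box_bump_eq_0:
  assumes "x \<notin> box a b" shows "box_bump a b k x = 0"
proof -
  obtain i where "x $ i \<le> a $ i \<or> b $ i \<le> x $ i"
    using assms by (auto simp: mem_box_cart not_less)
  then have "flat_exp 1 (real (Suc k) * (x $ i - a $ i)) *
      flat_exp 1 (real (Suc k) * (b $ i - x $ i)) = 0"
    by (auto simp: flat_exp_def zero_less_mult_iff)
  then show ?thesis
    unfolding box_bump_def flat_exp_scaled by (intro prod_zero) auto
qed

lemma flat_exp_1_tendsto: 
  assumes "t > 0" shows "(\<lambda>k. flat_exp 1 (real (Suc k) * t)) \<longlonglongrightarrow> 1"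
proof -
  have "(\<lambda>k. inverse (real (Suc k))) \<longlonglongrightarrow> 0" by (rule LIMSEQ_inverse_real_of_nat)
  then have "(\<lambda>k. exp (- (inverse (real (Suc k)) * inverse t))) \<longlonglongrightarrow> exp (- (0 * inverse t))"
    by (intro tendsto_intros)
  moreover have "exp (- (inverse (real (Suc k)) * inverse t)) = flat_exp 1 (real (Suc k) * t)" for k
    using assms by (simp add: flat_exp_def inverse_eq_divide del: of_nat_Suc)
  ultimately show ?thesis by simp
qed

lemma box_bump_tendsto: "(\<lambda>k. box_bump a b k x) \<longlonglongrightarrow> indicator (box a b) x"
proof (cases "x \<in> box a b")
  case True
  then have "(\<lambda>k. box_bump a b k x) \<longlonglongrightarrow> (\<Prod>i\<in>(UNIV::3 set). 1 * 1)"
    unfolding box_bump_def flat_exp_scaled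
    by (intro tendsto_prod tendsto_mult flat_exp_1_tendsto) (auto simp: mem_box_cart)
  then show ?thesis using True by simp
qed (simp add: box_bump_eq_0)

lemma test_functionsI:
  assumes "smooth \<phi>" "cbox a b \<subseteq> \<Omega>" "\<And>x. x \<notin> box a b \<Longrightarrow> \<phi> x = 0"
  shows "\<phi> \<in> test_functions \<Omega>"
proof -
  have sub: "closure {x. \<phi> x \<noteq> 0} \<subseteq> cbox a b"
    using assms(3) box_subset_cbox by (intro closure_minimal closed_cbox) blast
  moreover have "compact (closure {x. \<phi> x \<noteq> 0})"
    using sub by (meson bounded_cbox bounded_subset closed_closure compact_eq_bounded_closed)
  ultimately show ?thesis using assms by (auto simp: test_functions_def)
qed

lemma smooth_scaleR_right:
  fixes \<phi> :: "real^3 \<Rightarrow> real"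
  shows "smooth \<phi> \<Longrightarrow> smooth (\<lambda>x. \<phi> x *\<^sub>R e)"
  by (simp add: smooth_def C_diff_scaleR_right)

lemma smooth_imp_continuous: "smooth \<phi> \<Longrightarrow> continuous_on UNIV \<phi>"
  by (metis C_diff.simps(1) smooth_def)

lemma smooth_imp_continuous_partial: "smooth \<phi> \<Longrightarrow> continuous_on UNIV (partial_deriv i \<phi>)"
  unfolding smooth_def by (metis C_diff.simps One_nat_def)

lemma smooth_imp_continuous_grad: "smooth \<phi> \<Longrightarrow> continuous_on UNIV (grad \<phi>)"
  unfolding grad_def[abs_def] by (intro continuous_intros smooth_imp_continuous_partial)

lemma smooth_imp_continuous_curl:
  assumes "smooth \<phi>" shows "continuous_on UNIV (curl \<phi>)"
proof -
  have "continuous_on UNIV (\<lambda>x. curl \<phi> x $ i)" for i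
    using exhaust_3[of i] unfolding curl_def
    by (elim disjE; simp only: vector_3)
       (intro continuous_intros smooth_imp_continuous_partial assms)+
  then have "continuous_on UNIV (\<lambda>x. \<chi> i. curl \<phi> x $ i)" by (rule continuous_on_vec_lambda)
  then show ?thesis by simp
qed

section \<open>The fundamental lemma of the calculus of variations\<close>

text \<open>
  Growing boxes show that the total integral is \<open>0\<close>. Hence the sets over which \<open>g\<close> integrates to
  \<open>0\<close> are closed under complements, besides disjoint unions, and they include the sigma-algebra
  generated by the intersection-stable family of boxes.
\<close>

lemma AE_zero_if_box_integrals_zero:
  fixes g :: "'a::euclidean_space \<Rightarrow> real"
  assumes g: "integrable lborel g"
    and zero: "\<And>a b. set_lebesgue_integral lborel (box a b) g = 0"
  shows "AE x in lborel. g x = 0"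
proof (rule sigma_finite_measure.density_zero[OF sigma_finite_lborel g])
  have int: "set_integrable lborel A g" if "A \<in> sets borel" for A
    using that g unfolding set_integrable_def by (intro integrable_mult_indicator) auto
  have total: "integral\<^sup>L lborel g = 0"
  proof -
    have "(\<lambda>n. set_lebesgue_integral lborel (box (- (real n *\<^sub>R One)) (real n *\<^sub>R One)) g) \<longlonglongrightarrow>
        integral\<^sup>L lborel g"
      unfolding set_lebesgue_integral_def
    proof (rule integral_dominated_convergence[where w = "\<lambda>x. \<bar>g x\<bar>"])
      show "AE x in lborel. (\<lambda>n. indicat_real (box (- (real n *\<^sub>R One)) (real n *\<^sub>R One)) x *\<^sub>R g x)
          \<longlonglongrightarrow> g x"
      proof (intro AE_I2)
        fix x :: 'a
        obtain N where N: "x \<in> box (- (real N *\<^sub>R One)) (real N *\<^sub>R One)"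
          using UN_box_eq_UNIV by blast
        have "\<forall>\<^sub>F n in sequentially. indicat_real (box (- (real n *\<^sub>R One)) (real n *\<^sub>R One)) x *\<^sub>R g x = g x"
          using eventually_ge_at_top[of N]
        proof eventually_elim
          case (elim n)
          then have "x \<in> box (- (real n *\<^sub>R One)) (real n *\<^sub>R One)"
            using N by (fastforce simp: mem_box)
          then show ?case by simp
        qed
        then show "(\<lambda>n. indicat_real (box (- (real n *\<^sub>R One)) (real n *\<^sub>R One)) x *\<^sub>R g x) \<longlonglongrightarrow> g x"
          by (rule tendsto_eventually)
      qed
    qed (use g in \<open>auto simp: indicator_def\<close>)
    then show ?thesis using zero by (simp add: LIMSEQ_const_iff)
  qed
  fix A :: "'a set" assume "A \<in> sets lborel"
  then have A: "A \<in> sigma_sets UNIV (range (\<lambda>(a, b). box a b))"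
    by (simp add: borel_eq_box[where 'a='a])
  have borel: "B \<in> sets borel" if "B \<in> sigma_sets UNIV (range (\<lambda>(a, b). box a b))" for B :: "'a set"
    using that by (simp add: borel_eq_box[where 'a='a])
  have "Int_stable (range (\<lambda>(a, b). box a b :: 'a set))"
    by (auto simp: Int_stable_def box_Int_box)
  moreover have "range (\<lambda>(a, b). box a b :: 'a set) \<subseteq> Pow UNIV" by simp
  ultimately show "set_lebesgue_integral lborel A g = 0"
    using A
  proof (induction rule: sigma_sets_induct_disjoint)
    case (basic A) then show ?case using zero by auto
  next
    case empty show ?case by (simp add: set_lebesgue_integral_def)
  next
    case (compl A)
    have "integral\<^sup>L lborel g = set_lebesgue_integral lborel (A \<union> (UNIV - A)) g"
      by (simp add: set_lebesgue_integral_def)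
    also have "\<dots> = set_lebesgue_integral lborel A g + set_lebesgue_integral lborel (UNIV - A) g"
      using borel[OF compl(1)] by (intro set_integral_Un int) auto
    finally show ?case using total compl by simp
  next
    case (union A)
    have "set_lebesgue_integral lborel (\<Union>i. A i) g = (\<Sum>i. set_lebesgue_integral lborel (A i) g)"
    proof (rule lebesgue_integral_countable_add)
      have "A i \<in> sets borel" for i using union(2) by (intro borel) auto
      then show "A i \<in> sets lborel" "set_integrable lborel (\<Union>i. A i) g" for i by (auto intro!: int)
    qed (use union(1) in \<open>auto simp: disjoint_family_on_def\<close>)
    then show ?case using union(3) by simp
  qed
qed

text \<open>
  Bump functions converge boundedly to the indicator of a box, so \<open>d\<close> integrates to \<open>0\<close> over each
  box whose closure lies in \<open>\<Omega>\<close>. To stay inside \<open>\<Omega>\<close>, the generator argument is applied to \<open>d\<close>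
  restricted to one such box at a time; countably many of them cover \<open>\<Omega>\<close>.
\<close>

lemma AE_zero_if_test_integrals_zero:
  fixes d :: "real^3 \<Rightarrow> real"
  assumes "open \<Omega>" and d: "integrable (lebesgue_on \<Omega>) d"
    and zero: "\<And>\<phi>. \<phi> \<in> test_functions \<Omega> \<Longrightarrow> (\<integral>x. d x * \<phi> x \<partial>lebesgue_on \<Omega>) = 0"
  shows "AE x in lebesgue_on \<Omega>. d x = 0"
proof -
  have \<Omega>: "\<Omega> \<in> sets lebesgue" using \<open>open \<Omega>\<close> by (simp add: borel_open)
  have box_zero: "(\<integral>x. d x * indicator (box a b) x \<partial>lebesgue_on \<Omega>) = 0"
    if ab: "cbox a b \<subseteq> \<Omega>" for a b
  proof -
    have "(\<lambda>k. \<integral>x. d x * box_bump a b k x \<partial>lebesgue_on \<Omega>) \<longlonglongrightarrow>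
        (\<integral>x. d x * indicator (box a b) x \<partial>lebesgue_on \<Omega>)"
    proof (rule integral_dominated_convergence[where w = "\<lambda>x. \<bar>d x\<bar>"])
      show "(\<lambda>x. d x * indicator (box a b) x) \<in> borel_measurable (lebesgue_on \<Omega>)"
      proof (intro borel_measurable_times borel_measurable_integrable[OF d] borel_measurable_indicator)
        have "box a b \<in> sets lebesgue" "\<Omega> \<inter> box a b = box a b"
          using ab box_subset_cbox[of a b] by auto
        then show "box a b \<in> sets (lebesgue_on \<Omega>)" unfolding sets_restrict_space by (metis image_eqI)
      qed
      show "(\<lambda>x. d x * box_bump a b k x) \<in> borel_measurable (lebesgue_on \<Omega>)" for k
        using d \<Omega> smooth_imp_continuous[OF box_bump_smooth[of a b k]]
        by (intro borel_measurable_times borel_measurable_integrable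
            continuous_imp_measurable_on_sets_lebesgue) (auto intro: continuous_on_subset)
      show "AE x in lebesgue_on \<Omega>. (\<lambda>k. d x * box_bump a b k x) \<longlonglongrightarrow> d x * indicator (box a b) x"
        by (intro AE_I2 tendsto_mult tendsto_const box_bump_tendsto)
      show "AE x in lebesgue_on \<Omega>. norm (d x * box_bump a b k x) \<le> \<bar>d x\<bar>" for k
        using box_bump_bounds[of a b k] by (auto simp: abs_mult intro!: AE_I2 mult_left_le)
    qed (use d in auto)
    moreover have "(\<integral>x. d x * box_bump a b k x \<partial>lebesgue_on \<Omega>) = 0" for k
      by (rule zero, rule test_functionsI[OF box_bump_smooth ab box_bump_eq_0])
    ultimately show ?thesis by (simp add: LIMSEQ_const_iff)
  qed
  define e where "e x = indicator \<Omega> x * d x" for x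
  have e: "integrable lebesgue e"
    using d \<Omega> unfolding e_def by (subst (asm) integrable_restrict_space) auto
  \<comment> \<open>The generator argument lives on Borel sets, hence the passage to a Borel representative.\<close>
  then obtain g where g [measurable]: "g \<in> borel_measurable lborel"
    and eg: "AE x in lborel. e x = g x"
    using completion_ex_borel_measurable_real[of e lborel] by auto
  have eg': "AE x in lebesgue. e x = g x" using eg by (rule AE_completion)
  have "integrable lebesgue g"
    by (rule integrable_cong_AE_imp[OF e measurable_completion[OF g]])
       (use eg' in eventually_elim, simp)
  then have g_int: "integrable lborel g" using integrable_completion[OF g] by blast
  have g_box: "AE x in lebesgue. x \<in> box a b \<longrightarrow> g x = 0" if ab: "cbox a b \<subseteq> \<Omega>" for a b
  proof -
    have "AE x in lborel. indicator (box a b) x * g x = 0"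
    proof (rule AE_zero_if_box_integrals_zero)
      show "integrable lborel (\<lambda>x. indicator (box a b) x * g x)"
        using integrable_mult_indicator[OF _ g_int, of "box a b"] by simp
      fix p q :: "real^3"
      obtain r s where rs: "box p q \<inter> box a b = box r s" using box_Int_box[of p q a b] by blast
      have "set_lebesgue_integral lborel (box p q) (\<lambda>x. indicator (box a b) x * g x) =
          (\<integral>x. indicator (box r s) x * g x \<partial>lborel)"
        unfolding set_lebesgue_integral_def rs[symmetric]
        by (intro Bochner_Integration.integral_cong) (auto simp: indicator_def)
      also have "\<dots> = (\<integral>x. indicator (box r s) x * g x \<partial>lebesgue)"
        by (rule integral_completion[symmetric]) measurable
      also have "\<dots> = (\<integral>x. indicator (box r s) x * e x \<partial>lebesgue)"
      proof (rule integral_cong_AE)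
        show "(\<lambda>x. indicator (box r s) x * e x) \<in> borel_measurable lebesgue"
          using e by (intro borel_measurable_times borel_measurable_indicator) (auto simp: borel_open)
        show "(\<lambda>x. indicator (box r s) x * g x) \<in> borel_measurable lebesgue"
          by (rule measurable_completion) measurable
      qed (use eg' in auto)
      also have "\<dots> = (\<integral>x. d x * indicator (box r s) x \<partial>lebesgue_on \<Omega>)"
        using \<Omega> by (subst integral_restrict_space) (auto simp: e_def mult_ac)
      also have "\<dots> = 0"
      proof (cases "box r s = {}")
        case False
        then have "cbox r s = closure (box p q \<inter> box a b)" by (simp add: rs closure_box)
        also have "\<dots> \<subseteq> cbox a b"
          using box_subset_cbox by (intro closure_minimal closed_cbox) blast
        finally show ?thesis using ab by (intro box_zero) auto
      qed simp
      finally show "set_lebesgue_integral lborel (box p q) (\<lambda>x. indicator (box a b) x * g x) = 0" .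
    qed
    then have "AE x in lebesgue. indicator (box a b) x * g x = 0" by (rule AE_completion)
    then show ?thesis by eventually_elim (auto simp: indicator_def)
  qed
  obtain \<D> where \<D>: "countable \<D>" "\<D> \<subseteq> Pow \<Omega>" "\<And>X. X \<in> \<D> \<Longrightarrow> \<exists>a b. X = cbox a b" "\<Union>\<D> = \<Omega>"
    using open_countable_Union_open_cbox[OF \<open>open \<Omega>\<close>] by metis
  have "AE x in lebesgue. x \<in> X \<longrightarrow> g x = 0" if "X \<in> \<D>" for X
  proof -
    obtain a b where X: "X = cbox a b" "cbox a b \<subseteq> \<Omega>" using \<D>(2,3) \<open>X \<in> \<D>\<close> by blast
    have "AE x in lebesgue. x \<notin> cbox a b - box a b"
      using negligible_frontier_interval[of a b]
      by (intro AE_not_in) (simp add: negligible_iff_null_sets)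
    with g_box[OF X(2)] show ?thesis unfolding X(1) by eventually_elim auto
  qed
  then have "AE x in lebesgue. \<forall>X\<in>\<D>. x \<in> X \<longrightarrow> g x = 0" using \<D>(1) by (subst AE_ball_countable) auto
  with eg' have "AE x in lebesgue. x \<in> \<Omega> \<longrightarrow> d x = 0"
  proof eventually_elim
    case (elim x)
    show ?case
    proof
      assume "x \<in> \<Omega>"
      moreover from this obtain X where "X \<in> \<D>" "x \<in> X" using \<D>(4) by blast
      ultimately show "d x = 0" using elim by (auto simp: e_def)
    qed
  qed
  then show ?thesis using \<Omega> by (subst AE_restrict_space_iff) auto
qed

section \<open>Weak derivatives are determined almost everywhere\<close>

lemma L2_space_measurable: "f \<in> L2_space \<Omega> \<Longrightarrow> f \<in> borel_measurable (lebesgue_on \<Omega>)"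
  by (simp add: L2_space_def)

lemma integrable_L2_inner:
  assumes "f \<in> L2_space \<Omega>" "g \<in> L2_space \<Omega>"
  shows "integrable (lebesgue_on \<Omega>) (\<lambda>x. f x \<bullet> g x)"
proof (rule Bochner_Integration.integrable_bound)
  show "integrable (lebesgue_on \<Omega>) (\<lambda>x. (norm (f x))\<^sup>2 + (norm (g x))\<^sup>2)"
    using assms by (auto simp: L2_space_def)
  show "(\<lambda>x. f x \<bullet> g x) \<in> borel_measurable (lebesgue_on \<Omega>)"
    using assms by (intro borel_measurable_inner L2_space_measurable)
  show "AE x in lebesgue_on \<Omega>. norm (f x \<bullet> g x) \<le> norm ((norm (f x))\<^sup>2 + (norm (g x))\<^sup>2)"
  proof (intro AE_I2)
    fix x
    have "\<bar>f x \<bullet> g x\<bar> \<le> norm (f x) * norm (g x)" by (rule Cauchy_Schwarz_ineq2)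
    moreover have "0 \<le> norm (f x) * norm (g x)" by simp
    moreover have "2 * norm (f x) * norm (g x) \<le> (norm (f x))\<^sup>2 + (norm (g x))\<^sup>2"
      by (rule sum_squares_bound)
    ultimately show "norm (f x \<bullet> g x) \<le> norm ((norm (f x))\<^sup>2 + (norm (g x))\<^sup>2)" by simp
  qed
qed

lemma L2_space_lincomb:
  assumes "f \<in> L2_space \<Omega>" "g \<in> L2_space \<Omega>"
  shows "(\<lambda>x. a *\<^sub>R f x + b *\<^sub>R g x) \<in> L2_space \<Omega>"
proof -
  have "(norm (a *\<^sub>R f x + b *\<^sub>R g x))\<^sup>2 =
      a\<^sup>2 * (norm (f x))\<^sup>2 + 2 * a * b * (f x \<bullet> g x) + b\<^sup>2 * (norm (g x))\<^sup>2" for x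
    unfolding power2_norm_eq_inner
    by (simp add: inner_simps inner_commute power2_eq_square algebra_simps)
  then show ?thesis
    using assms integrable_L2_inner[OF assms]
    by (auto simp: L2_space_def intro!: borel_measurable_add borel_measurable_scaleR)
qed

lemma L2_inner_lincomb:
  assumes "f \<in> L2_space \<Omega>" "g \<in> L2_space \<Omega>" "h \<in> L2_space \<Omega>"
  shows "L2_inner \<Omega> (\<lambda>x. a *\<^sub>R f x + b *\<^sub>R g x) h = a * L2_inner \<Omega> f h + b * L2_inner \<Omega> g h"
  using integrable_L2_inner[OF assms(1,3)] integrable_L2_inner[OF assms(2,3)]
  by (simp add: L2_inner_def inner_simps)

lemma L2_inner_cong_AE:
  assumes "f \<in> borel_measurable (lebesgue_on \<Omega>)" "f' \<in> borel_measurable (lebesgue_on \<Omega>)"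
    "g \<in> borel_measurable (lebesgue_on \<Omega>)" "AE x in lebesgue_on \<Omega>. f x = f' x"
  shows "L2_inner \<Omega> f g = L2_inner \<Omega> f' g"
  unfolding L2_inner_def
  by (rule integral_cong_AE) (use assms in \<open>auto intro!: borel_measurable_inner elim!: eventually_mono\<close>)

lemma continuous_in_L2_space:
  assumes "open \<Omega>" "bounded \<Omega>" "continuous_on UNIV f"
  shows "f \<in> L2_space \<Omega>"
proof -
  have \<Omega>: "\<Omega> \<in> lmeasurable" using assms by (intro lmeasurable_open)
  have meas: "f \<in> borel_measurable (lebesgue_on \<Omega>)"
    using \<Omega> assms(3) by (intro continuous_imp_measurable_on_sets_lebesgue)
      (auto intro: continuous_on_subset simp: fmeasurableD)
  have "bounded (f ` closure \<Omega>)"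
    using assms by (intro compact_imp_bounded compact_continuous_image)
      (auto intro: continuous_on_subset)
  then obtain B where B: "\<And>x. x \<in> closure \<Omega> \<Longrightarrow> norm (f x) \<le> B" by (auto simp: bounded_iff)
  have "integrable (lebesgue_on \<Omega>) (\<lambda>x. (norm (f x))\<^sup>2)"
  proof (rule finite_measure.integrable_const_bound[OF finite_measure_lebesgue_on[OF \<Omega>]])
    show "AE x in lebesgue_on \<Omega>. norm ((norm (f x))\<^sup>2) \<le> B\<^sup>2"
      using B closure_subset[of \<Omega>] by (intro AE_I2) (auto intro!: power_mono)
  qed (use meas in measurable)
  with meas show ?thesis by (simp add: L2_space_def)
qed

lemma test_functions_in_L2_space:
  assumes "open \<Omega>" "bounded \<Omega>" "\<phi> \<in> test_functions \<Omega>"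
  shows "\<phi> \<in> L2_space \<Omega>"
  using assms by (intro continuous_in_L2_space smooth_imp_continuous) (auto simp: test_functions_def)

text \<open>
  Vector-valued fields reduce to the scalar fundamental lemma by testing with \<open>\<phi> *\<^sub>R e\<close> for each
  basis vector \<open>e\<close>.
\<close>

lemma L2_inner_test_functions_unique:
  fixes c d :: "real^3 \<Rightarrow> 'b::euclidean_space"
  assumes \<Omega>: "open \<Omega>" "bounded \<Omega>" and c: "c \<in> L2_space \<Omega>" and d: "d \<in> L2_space \<Omega>"
    and eq: "\<And>\<phi>. \<phi> \<in> test_functions \<Omega> \<Longrightarrow> L2_inner \<Omega> c \<phi> = L2_inner \<Omega> d \<phi>"
  shows "AE x in lebesgue_on \<Omega>. c x = d x"
proof -
  have "AE x in lebesgue_on \<Omega>. (c x - d x) \<bullet> e = 0" if "e \<in> Basis" for e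
  proof (rule AE_zero_if_test_integrals_zero[OF \<Omega>(1)])
    have e: "(\<lambda>x. e) \<in> L2_space \<Omega>" using \<Omega> by (intro continuous_in_L2_space) auto
    have cd: "(\<lambda>x. 1 *\<^sub>R c x + (- 1) *\<^sub>R d x) \<in> L2_space \<Omega>" by (rule L2_space_lincomb[OF c d])
    from integrable_L2_inner[OF cd e] show "integrable (lebesgue_on \<Omega>) (\<lambda>x. (c x - d x) \<bullet> e)"
      by simp
    fix \<phi> :: "real^3 \<Rightarrow> real" assume \<phi>: "\<phi> \<in> test_functions \<Omega>"
    have "closure {x. \<phi> x *\<^sub>R e \<noteq> 0} = closure {x. \<phi> x \<noteq> 0}" using nonzero_Basis[OF that] by simp
    moreover have "compact (closure {x. \<phi> x \<noteq> 0})" using \<phi> by (simp add: test_functions_def)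
    ultimately have \<phi>e: "(\<lambda>x. \<phi> x *\<^sub>R e) \<in> test_functions \<Omega>"
      using \<phi> unfolding test_functions_def by (auto simp only: mem_Collect_eq smooth_scaleR_right)
    then have L2: "(\<lambda>x. \<phi> x *\<^sub>R e) \<in> L2_space \<Omega>" using \<Omega> by (intro test_functions_in_L2_space)
    have "(\<integral>x. (c x - d x) \<bullet> e * \<phi> x \<partial>lebesgue_on \<Omega>) =
        L2_inner \<Omega> (\<lambda>x. 1 *\<^sub>R c x + (- 1) *\<^sub>R d x) (\<lambda>x. \<phi> x *\<^sub>R e)"
      by (simp add: L2_inner_def mult.commute)
    also have "\<dots> = 0" unfolding L2_inner_lincomb[OF c d L2] using eq[OF \<phi>e] by simp
    finally show "(\<integral>x. (c x - d x) \<bullet> e * \<phi> x \<partial>lebesgue_on \<Omega>) = 0" .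
  qed
  then have "AE x in lebesgue_on \<Omega>. \<forall>e\<in>Basis. (c x - d x) \<bullet> e = 0"
    by (simp add: AE_finite_all)
  then show ?thesis
    by eventually_elim (metis euclidean_all_zero_iff right_minus_eq)
qed

lemma grad_test_in_L2_space:
  assumes "open \<Omega>" "bounded \<Omega>" "\<phi> \<in> test_functions \<Omega>"
  shows "grad \<phi> \<in> L2_space \<Omega>"
  using assms by (intro continuous_in_L2_space smooth_imp_continuous_grad) (auto simp: test_functions_def)

lemma curl_test_in_L2_space:
  assumes "open \<Omega>" "bounded \<Omega>" "\<phi> \<in> test_functions \<Omega>"
  shows "curl \<phi> \<in> L2_space \<Omega>"
  using assms by (intro continuous_in_L2_space smooth_imp_continuous_curl) (auto simp: test_functions_def)

lemma weak_div_unique: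
  assumes \<Omega>: "open \<Omega>" "bounded \<Omega>" and v: "v \<in> L2_space \<Omega>" "w \<in> L2_space \<Omega>"
    and vw: "AE x in lebesgue_on \<Omega>. v x = w x"
    and d: "has_weak_div \<Omega> v d" "has_weak_div \<Omega> w d'"
  shows "AE x in lebesgue_on \<Omega>. d x = d' x"
proof (rule L2_inner_test_functions_unique[OF \<Omega>])
  fix \<phi> :: "real^3 \<Rightarrow> real" assume \<phi>: "\<phi> \<in> test_functions \<Omega>"
  have "L2_inner \<Omega> v (grad \<phi>) = L2_inner \<Omega> w (grad \<phi>)"
    using vw by (intro L2_inner_cong_AE L2_space_measurable v grad_test_in_L2_space[OF \<Omega> \<phi>])
  then show "L2_inner \<Omega> d \<phi> = L2_inner \<Omega> d' \<phi>" using d \<phi> by (simp add: has_weak_div_def)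
qed (use d in \<open>auto simp: has_weak_div_def\<close>)

lemma weak_curl_unique:
  assumes \<Omega>: "open \<Omega>" "bounded \<Omega>" and v: "v \<in> L2_space \<Omega>" "w \<in> L2_space \<Omega>"
    and vw: "AE x in lebesgue_on \<Omega>. v x = w x"
    and c: "has_weak_curl \<Omega> v c" "has_weak_curl \<Omega> w c'"
  shows "AE x in lebesgue_on \<Omega>. c x = c' x"
proof (rule L2_inner_test_functions_unique[OF \<Omega>])
  fix \<phi> :: "real^3 \<Rightarrow> real^3" assume \<phi>: "\<phi> \<in> test_functions \<Omega>"
  have "L2_inner \<Omega> v (curl \<phi>) = L2_inner \<Omega> w (curl \<phi>)"
    using vw by (intro L2_inner_cong_AE L2_space_measurable v curl_test_in_L2_space[OF \<Omega> \<phi>])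
  then show "L2_inner \<Omega> c \<phi> = L2_inner \<Omega> c' \<phi>" using c \<phi> by (simp add: has_weak_curl_def)
qed (use c in \<open>auto simp: has_weak_curl_def\<close>)

lemma has_weak_div_lincomb:
  assumes \<Omega>: "open \<Omega>" "bounded \<Omega>" and v: "v \<in> L2_space \<Omega>" "w \<in> L2_space \<Omega>"
    and d: "has_weak_div \<Omega> v d" "has_weak_div \<Omega> w d'"
  shows "has_weak_div \<Omega> (\<lambda>x. a *\<^sub>R v x + b *\<^sub>R w x) (\<lambda>x. a *\<^sub>R d x + b *\<^sub>R d' x)"
proof -
  have L2: "d \<in> L2_space \<Omega>" "d' \<in> L2_space \<Omega>" using d by (auto simp: has_weak_div_def)
  show ?thesis
    unfolding has_weak_div_def
    using d by (auto simp: L2_space_lincomb L2 has_weak_div_def algebra_simps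
        L2_inner_lincomb[OF v grad_test_in_L2_space[OF \<Omega>]]
        L2_inner_lincomb[OF L2 test_functions_in_L2_space[OF \<Omega>]]
        simp del: real_scaleR_def)
qed

lemma has_weak_curl_lincomb:
  assumes \<Omega>: "open \<Omega>" "bounded \<Omega>" and v: "v \<in> L2_space \<Omega>" "w \<in> L2_space \<Omega>"
    and d: "has_weak_curl \<Omega> v d" "has_weak_curl \<Omega> w d'"
  shows "has_weak_curl \<Omega> (\<lambda>x. a *\<^sub>R v x + b *\<^sub>R w x) (\<lambda>x. a *\<^sub>R d x + b *\<^sub>R d' x)"
proof -
  have L2: "d \<in> L2_space \<Omega>" "d' \<in> L2_space \<Omega>" using d by (auto simp: has_weak_curl_def)
  show ?thesis
    unfolding has_weak_curl_def
    using d by (auto simp: L2_space_lincomb L2 has_weak_curl_def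
        L2_inner_lincomb[OF v curl_test_in_L2_space[OF \<Omega>]]
        L2_inner_lincomb[OF L2 test_functions_in_L2_space[OF \<Omega>]])
qed

definition H_div_curl :: "(real^3) set \<Rightarrow> (real^3 \<Rightarrow> real^3) set" where
  "H_div_curl \<Omega> = H_div \<Omega> \<inter> H_curl \<Omega>"

lemma H_div_curlD:
  assumes "v \<in> H_div_curl \<Omega>"
  shows "v \<in> L2_space \<Omega>" "has_weak_div \<Omega> v (wdiv \<Omega> v)" "has_weak_curl \<Omega> v (wcurl \<Omega> v)"
    "wdiv \<Omega> v \<in> L2_space \<Omega>" "wcurl \<Omega> v \<in> L2_space \<Omega>"
proof -
  show "v \<in> L2_space \<Omega>" using assms by (simp add: H_div_curl_def H_div_def)
  show d: "has_weak_div \<Omega> v (wdiv \<Omega> v)"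
    using assms someI_ex[of "has_weak_div \<Omega> v"] unfolding wdiv_def H_div_curl_def H_div_def by blast
  show c: "has_weak_curl \<Omega> v (wcurl \<Omega> v)"
    using assms someI_ex[of "has_weak_curl \<Omega> v"] unfolding wcurl_def H_div_curl_def H_curl_def by blast
  show "wdiv \<Omega> v \<in> L2_space \<Omega>" "wcurl \<Omega> v \<in> L2_space \<Omega>"
    using c d by (auto simp: has_weak_div_def has_weak_curl_def)
qed

lemma H_div_curl_lincomb:
  assumes \<Omega>: "open \<Omega>" "bounded \<Omega>" and v: "v \<in> H_div_curl \<Omega>" "w \<in> H_div_curl \<Omega>"
  shows "(\<lambda>x. a *\<^sub>R v x + b *\<^sub>R w x) \<in> H_div_curl \<Omega>"
  using has_weak_div_lincomb[OF \<Omega> H_div_curlD(1)[OF v(1)] H_div_curlD(1)[OF v(2)]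
      H_div_curlD(2)[OF v(1)] H_div_curlD(2)[OF v(2)]]
    has_weak_curl_lincomb[OF \<Omega> H_div_curlD(1)[OF v(1)] H_div_curlD(1)[OF v(2)]
      H_div_curlD(3)[OF v(1)] H_div_curlD(3)[OF v(2)]]
    L2_space_lincomb[OF H_div_curlD(1)[OF v(1)] H_div_curlD(1)[OF v(2)]]
  unfolding H_div_curl_def H_div_def H_curl_def by blast

text \<open>
  A field together with its divergence and curl. In the Euclidean product norm the
  norm of \<open>H(div) \<inter> H(curl)\<close> is the \<open>L\<^sup>2\<close> norm of the jet, and every form of the problem is the
  integral of a pointwise form in jets.
\<close>

definition jet :: "(real^3) set \<Rightarrow> (real^3 \<Rightarrow> real^3) \<Rightarrow> real^3 \<Rightarrow> (real^3) \<times> real \<times> (real^3)" where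
  "jet \<Omega> v x = (v x, wdiv \<Omega> v x, wcurl \<Omega> v x)"

lemma norm_jet: "(norm (jet \<Omega> v x))\<^sup>2 = (norm (v x))\<^sup>2 + (norm (wdiv \<Omega> v x))\<^sup>2 + (norm (wcurl \<Omega> v x))\<^sup>2"
  by (simp add: jet_def norm_prod_def)

lemma jet_in_L2_space:
  assumes "v \<in> H_div_curl \<Omega>"
  shows "jet \<Omega> v \<in> L2_space \<Omega>"
  using H_div_curlD[OF assms] norm_jet[of \<Omega> v]
  by (auto simp: L2_space_def jet_def[abs_def] intro!: borel_measurable_Pair)

text \<open>
  \<open>wdiv\<close> and \<open>wcurl\<close> choose a representative for each field separately, so additivity is only
  available almost everywhere, through uniqueness.
\<close>

lemma jet_lincomb:
  assumes \<Omega>: "open \<Omega>" "bounded \<Omega>" and v: "v \<in> H_div_curl \<Omega>" "w \<in> H_div_curl \<Omega>"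
  shows "AE x in lebesgue_on \<Omega>.
    jet \<Omega> (\<lambda>x. a *\<^sub>R v x + b *\<^sub>R w x) x = a *\<^sub>R jet \<Omega> v x + b *\<^sub>R jet \<Omega> w x"
proof -
  let ?u = "\<lambda>x. a *\<^sub>R v x + b *\<^sub>R w x"
  note V = H_div_curlD[OF v(1)] and W = H_div_curlD[OF v(2)]
    and u = H_div_curlD[OF H_div_curl_lincomb[OF assms]]
  have "AE x in lebesgue_on \<Omega>. wdiv \<Omega> ?u x = a *\<^sub>R wdiv \<Omega> v x + b *\<^sub>R wdiv \<Omega> w x"
    by (rule weak_div_unique[OF \<Omega> u(1,1) _ u(2)
          has_weak_div_lincomb[OF \<Omega> V(1) W(1) V(2) W(2)]]) simp
  moreover have "AE x in lebesgue_on \<Omega>. wcurl \<Omega> ?u x = a *\<^sub>R wcurl \<Omega> v x + b *\<^sub>R wcurl \<Omega> w x"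
    by (rule weak_curl_unique[OF \<Omega> u(1,1) _ u(3)
          has_weak_curl_lincomb[OF \<Omega> V(1) W(1) V(3) W(3)]]) simp
  ultimately show ?thesis by eventually_elim (simp add: jet_def)
qed

lemma jet_AE_0:
  assumes \<Omega>: "open \<Omega>" "bounded \<Omega>" and v: "v \<in> H_div_curl \<Omega>" and 0: "AE x in lebesgue_on \<Omega>. v x = 0"
  shows "AE x in lebesgue_on \<Omega>. jet \<Omega> v x = 0"
proof -
  note D = H_div_curlD[OF v]
  have z: "AE x in lebesgue_on \<Omega>. v x = 0 *\<^sub>R v x + 0 *\<^sub>R v x" using 0 by simp
  have "AE x in lebesgue_on \<Omega>. wdiv \<Omega> v x = 0 *\<^sub>R wdiv \<Omega> v x + 0 *\<^sub>R wdiv \<Omega> v x"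
    by (rule weak_div_unique[OF \<Omega> D(1) L2_space_lincomb[OF D(1,1)] z D(2)
          has_weak_div_lincomb[OF \<Omega> D(1,1,2,2)]])
  moreover have "AE x in lebesgue_on \<Omega>. wcurl \<Omega> v x = 0 *\<^sub>R wcurl \<Omega> v x + 0 *\<^sub>R wcurl \<Omega> v x"
    by (rule weak_curl_unique[OF \<Omega> D(1) L2_space_lincomb[OF D(1,1)] z D(3)
          has_weak_curl_lincomb[OF \<Omega> D(1,1,3,3)]])
  ultimately show ?thesis using 0 by eventually_elim (simp add: jet_def zero_prod_def)
qed

lemma L2_norm_power2:
  "(L2_norm \<Omega> f)\<^sup>2 = (\<integral>x. (norm (f x))\<^sup>2 \<partial>lebesgue_on \<Omega>)"
  by (simp add: L2_norm_def L2_inner_def power2_norm_eq_inner integral_nonneg_AE)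

lemma DC_norm_power2:
  "(DC_norm \<Omega> v)\<^sup>2 = (L2_norm \<Omega> v)\<^sup>2 + (L2_norm \<Omega> (wdiv \<Omega> v))\<^sup>2 + (L2_norm \<Omega> (wcurl \<Omega> v))\<^sup>2"
  by (simp add: DC_norm_def)

lemma DC_norm_nonneg: "0 \<le> DC_norm \<Omega> v"
  by (simp add: DC_norm_def)

lemma DC_norm_eq_jet:
  assumes "v \<in> H_div_curl \<Omega>"
  shows "(DC_norm \<Omega> v)\<^sup>2 = (\<integral>x. (norm (jet \<Omega> v x))\<^sup>2 \<partial>lebesgue_on \<Omega>)"
  using H_div_curlD[OF assms] unfolding DC_norm_power2 L2_norm_power2 norm_jet
  by (simp add: L2_space_def)

lemma DC_norm_eq_0_iff:
  assumes \<Omega>: "open \<Omega>" "bounded \<Omega>" and v: "v \<in> H_div_curl \<Omega>"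
  shows "DC_norm \<Omega> v = 0 \<longleftrightarrow> (AE x in lebesgue_on \<Omega>. v x = 0)"
    and "DC_norm \<Omega> v = 0 \<longleftrightarrow> (AE x in lebesgue_on \<Omega>. jet \<Omega> v x = 0)"
proof -
  have "DC_norm \<Omega> v = 0 \<longleftrightarrow> (\<integral>x. (norm (jet \<Omega> v x))\<^sup>2 \<partial>lebesgue_on \<Omega>) = 0"
    by (simp flip: DC_norm_eq_jet[OF v])
  also have "\<dots> \<longleftrightarrow> (AE x in lebesgue_on \<Omega>. (norm (jet \<Omega> v x))\<^sup>2 = 0)"
    using jet_in_L2_space[OF v] by (intro integral_nonneg_eq_0_iff_AE) (auto simp: L2_space_def)
  finally show *: "DC_norm \<Omega> v = 0 \<longleftrightarrow> (AE x in lebesgue_on \<Omega>. jet \<Omega> v x = 0)" by simp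
  have "AE x in lebesgue_on \<Omega>. v x = 0" if "AE x in lebesgue_on \<Omega>. jet \<Omega> v x = 0"
    using that by eventually_elim (simp add: jet_def zero_prod_def)
  then show "DC_norm \<Omega> v = 0 \<longleftrightarrow> (AE x in lebesgue_on \<Omega>. v x = 0)"
    using * jet_AE_0[OF \<Omega> v] by blast
qed

section \<open>Essentially bounded functions\<close>

definition Linfty :: "(real^3) set \<Rightarrow> (real^3 \<Rightarrow> 'b::euclidean_space) set" where
  "Linfty \<Omega> = {f. f \<in> borel_measurable (lebesgue_on \<Omega>) \<and> ess_bounded \<Omega> f}"

lemma Linfty_measurable: "f \<in> Linfty \<Omega> \<Longrightarrow> f \<in> borel_measurable (lebesgue_on \<Omega>)"
  by (simp add: Linfty_def)

lemma LinftyE: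
  assumes "f \<in> Linfty \<Omega>"
  obtains B where "B \<ge> 0" "AE x in lebesgue_on \<Omega>. norm (f x) \<le> B"
proof -
  obtain B where B: "AE x in lebesgue_on \<Omega>. norm (f x) \<le> B"
    using assms by (auto simp: Linfty_def ess_bounded_def)
  then have "AE x in lebesgue_on \<Omega>. norm (f x) \<le> max B 0" by eventually_elim simp
  then show ?thesis by (intro that[of "max B 0"]) auto
qed

lemma LinftyI:
  assumes "f \<in> borel_measurable (lebesgue_on \<Omega>)" "AE x in lebesgue_on \<Omega>. norm (f x) \<le> B"
  shows "f \<in> Linfty \<Omega>"
  using assms by (auto simp: Linfty_def ess_bounded_def)

lemma Linfty_const: "(\<lambda>x. c) \<in> Linfty \<Omega>"
  by (rule LinftyI[where B = "norm c"]) auto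

lemma Linfty_bilinear:
  fixes h :: "'a::euclidean_space \<Rightarrow> 'b::euclidean_space \<Rightarrow> 'c::euclidean_space"
  assumes h: "bounded_bilinear h" and f: "f \<in> Linfty \<Omega>" and g: "g \<in> Linfty \<Omega>"
  shows "(\<lambda>x. h (f x) (g x)) \<in> Linfty \<Omega>"
proof -
  obtain K where K: "K > 0" "\<And>a b. norm (h a b) \<le> norm a * norm b * K"
    using bounded_bilinear.pos_bounded[OF h] by blast
  obtain A where A: "A \<ge> 0" "AE x in lebesgue_on \<Omega>. norm (f x) \<le> A" using f by (rule LinftyE)
  obtain B where B: "B \<ge> 0" "AE x in lebesgue_on \<Omega>. norm (g x) \<le> B" using g by (rule LinftyE)
  have "continuous_on UNIV (\<lambda>z. h (fst z) (snd z))"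
    by (intro bounded_bilinear.continuous_on[OF h] continuous_intros)
  then have "(\<lambda>x. h (f x) (g x)) \<in> borel_measurable (lebesgue_on \<Omega>)"
    by (rule borel_measurable_continuous_Pair[OF Linfty_measurable[OF f] Linfty_measurable[OF g]])
  moreover from A(2) B(2) have "AE x in lebesgue_on \<Omega>. norm (h (f x) (g x)) \<le> A * B * K"
  proof eventually_elim
    case (elim x)
    have "norm (h (f x) (g x)) \<le> norm (f x) * norm (g x) * K" by (rule K)
    also have "\<dots> \<le> A * B * K" using elim A(1) K(1) by (intro mult_right_mono mult_mono) auto
    finally show ?case .
  qed
  ultimately show ?thesis by (rule LinftyI)
qed

lemma Linfty_linear:
  fixes h :: "'a::euclidean_space \<Rightarrow> 'b::euclidean_space"
  assumes h: "bounded_linear h" and f: "f \<in> Linfty \<Omega>"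
  shows "(\<lambda>x. h (f x)) \<in> Linfty \<Omega>"
  using Linfty_bilinear[OF bounded_bilinear.comp[OF bounded_bilinear_scaleR bounded_linear_ident h]
      Linfty_const[of 1] f] by simp

lemma Linfty_Pair:
  assumes "f \<in> Linfty \<Omega>" "g \<in> Linfty \<Omega>"
  shows "(\<lambda>x. (f x, g x)) \<in> Linfty \<Omega>"
proof -
  obtain A where A: "AE x in lebesgue_on \<Omega>. norm (f x) \<le> A" using assms(1) by (rule LinftyE)
  obtain B where B: "AE x in lebesgue_on \<Omega>. norm (g x) \<le> B" using assms(2) by (rule LinftyE)
  from A B have "AE x in lebesgue_on \<Omega>. norm (f x, g x) \<le> A + B"
    by eventually_elim (rule order_trans[OF norm_Pair_le add_mono])
  then show ?thesis
    by (rule LinftyI[OF borel_measurable_Pair[OF assms[THEN Linfty_measurable]]])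
qed

lemma Linfty_add:
  assumes "f \<in> Linfty \<Omega>" "g \<in> Linfty \<Omega>"
  shows "(\<lambda>x. f x + g x) \<in> Linfty \<Omega>"
  using Linfty_linear[OF bounded_linear_add[OF bounded_linear_fst bounded_linear_snd] Linfty_Pair[OF assms]]
  by simp

lemma Linfty_diff:
  assumes "f \<in> Linfty \<Omega>" "g \<in> Linfty \<Omega>"
  shows "(\<lambda>x. f x - g x) \<in> Linfty \<Omega>"
  using Linfty_linear[OF bounded_linear_sub[OF bounded_linear_fst bounded_linear_snd] Linfty_Pair[OF assms]]
  by simp

lemmas Linfty_fst = Linfty_linear[OF bounded_linear_fst]
lemmas Linfty_snd = Linfty_linear[OF bounded_linear_snd]
lemmas Linfty_inner = Linfty_bilinear[OF bounded_bilinear_inner]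
lemmas Linfty_scaleR = Linfty_bilinear[OF bounded_bilinear_scaleR]
lemmas Linfty_mult = Linfty_bilinear[where 'a = real and 'b = real and 'c = real, OF bounded_bilinear_mult]

lemmas Linfty_intros = Linfty_const Linfty_add Linfty_diff Linfty_mult Linfty_inner Linfty_scaleR
  Linfty_Pair Linfty_fst Linfty_snd

lemma integrable_Linfty:
  fixes f :: "real^3 \<Rightarrow> 'b::euclidean_space"
  assumes "open \<Omega>" "bounded \<Omega>" "f \<in> Linfty \<Omega>"
  shows "integrable (lebesgue_on \<Omega>) f"
proof -
  obtain B where "AE x in lebesgue_on \<Omega>. norm (f x) \<le> B" using assms(3) by (rule LinftyE)
  then show ?thesis
    using assms by (intro finite_measure.integrable_const_bound[OF finite_measure_lebesgue_on]
        lmeasurable_open Linfty_measurable)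
qed

lemma Linfty_in_L2_space:
  fixes f :: "real^3 \<Rightarrow> 'b::euclidean_space"
  assumes "open \<Omega>" "bounded \<Omega>" "f \<in> Linfty \<Omega>"
  shows "f \<in> L2_space \<Omega>"
  using integrable_Linfty[OF assms(1,2) Linfty_inner[OF assms(3,3)]] Linfty_measurable[OF assms(3)]
  by (simp add: L2_space_def power2_norm_eq_inner)

section \<open>Well-posedness of coercive problems on finite-dimensional spaces\<close>

text \<open>
  \<open>A\<close> is thought of as a Gram matrix \<open>a (b i) (b j)\<close> of a coercive form and \<open>f\<close> as a functional; the
  hypothesis says that a vector on which the quadratic form vanishes is annihilated by both. Adding
  the last basis vector \<open>b m\<close>, let \<open>w\<close> be its projection to the span of the others with respect to
  the form, and \<open>z = b m - w\<close>. If the form does not vanish at \<open>z\<close>, a multiple of \<open>z\<close> corrects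
  the solution \<open>u\<close> on the smaller span; if it does, \<open>b m\<close> and \<open>w\<close> are
  indistinguishable and \<open>u\<close> already solves the last equation.
\<close>

lemma semidefinite_system_solvable:
  fixes A :: "nat \<Rightarrow> nat \<Rightarrow> real"
  assumes "\<And>c. (\<Sum>i<m. \<Sum>j<m. c i * c j * A i j) = 0 \<Longrightarrow>
    (\<forall>j<m. (\<Sum>i<m. c i * A j i) = 0) \<and> (\<Sum>j<m. c j * f j) = 0"
  shows "\<exists>c. \<forall>j<m. (\<Sum>i<m. c i * A i j) = f j"
  using assms
proof (induction m arbitrary: f)
  case 0
  then show ?case by simp
next
  case (Suc m)
  have restrict: "(\<forall>j<Suc m. (\<Sum>i<m. c i * A j i) = 0) \<and> (\<Sum>j<m. c j * f j) = 0"
    if "(\<Sum>i<m. \<Sum>j<m. c i * c j * A i j) = 0" for c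
    using Suc.prems[of "c(m := 0)"] that by simp
  obtain w where w: "\<And>j. j < m \<Longrightarrow> (\<Sum>i<m. w i * A i j) = A m j"
  proof -
    have "(\<forall>j<m. (\<Sum>i<m. c i * A j i) = 0) \<and> (\<Sum>j<m. c j * A m j) = 0"
      if "(\<Sum>i<m. \<Sum>j<m. c i * c j * A i j) = 0" for c
      using restrict[OF that] by simp
    from Suc.IH[OF this] show ?thesis using that by blast
  qed
  obtain u where u: "\<And>j. j < m \<Longrightarrow> (\<Sum>i<m. u i * A i j) = f j"
  proof -
    have "(\<forall>j<m. (\<Sum>i<m. c i * A j i) = 0) \<and> (\<Sum>j<m. c j * f j) = 0"
      if "(\<Sum>i<m. \<Sum>j<m. c i * c j * A i j) = 0" for c
      using restrict[OF that] by simp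
    from Suc.IH[OF this] show ?thesis using that by blast
  qed
  define z where "z i = (if i < m then - w i else 1)" for i
  have z_sum: "(\<Sum>i<Suc m. z i * g i) = g m - (\<Sum>i<m. w i * g i)" for g
    by (simp add: z_def sum_negf)
  \<comment> \<open>Since \<open>z\<close> is orthogonal to the other basis vectors, \<open>s\<close> is the form at \<open>z\<close>.\<close>
  define s where "s = (\<Sum>i<Suc m. z i * A i m)"
  have z_row: "(\<Sum>i<Suc m. z i * A i j) = 0" if "j < m" for j
    unfolding z_sum using w[OF that] by simp
  show ?case
  proof (cases "s = 0")
    case True
    have "(\<Sum>i<Suc m. \<Sum>j<Suc m. z i * z j * A i j) = (\<Sum>j<Suc m. z j * (\<Sum>i<Suc m. z i * A i j))"
      by (subst sum.swap) (simp add: sum_distrib_left mult_ac del: sum.lessThan_Suc)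
    also have "\<dots> = z m * s + (\<Sum>j<m. z j * (\<Sum>i<Suc m. z i * A i j))"
      unfolding s_def by simp
    also have "\<dots> = 0" using True z_row by (simp del: sum.lessThan_Suc)
    finally have null: "(\<Sum>i<Suc m. \<Sum>j<Suc m. z i * z j * A i j) = 0" .
    have col: "A j m = (\<Sum>i<m. w i * A j i)" if "j < m" for j
      using Suc.prems[OF null, THEN conjunct1, rule_format, of j] that unfolding z_sum by simp
    have fm: "f m = (\<Sum>j<m. w j * f j)"
      using Suc.prems[OF null, THEN conjunct2] unfolding z_sum by simp
    have "(\<Sum>i<m. u i * A i m) = (\<Sum>i<m. \<Sum>j<m. w j * (u i * A i j))"
      by (simp add: col sum_distrib_left mult_ac)
    also have "\<dots> = (\<Sum>j<m. w j * (\<Sum>i<m. u i * A i j))"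
      by (subst sum.swap) (simp add: sum_distrib_left)
    also have "\<dots> = f m" unfolding fm by (simp add: u)
    finally have "\<forall>j<Suc m. (\<Sum>i<Suc m. (u(m := 0)) i * A i j) = f j"
      using u by (auto simp: less_Suc_eq)
    then show ?thesis by blast
  next
    case False
    define t where "t = (f m - (\<Sum>i<m. u i * A i m)) / s"
    define c where "c i = (u(m := 0)) i + t * z i" for i
    have "(\<Sum>i<Suc m. c i * A i j) = (\<Sum>i<m. u i * A i j) + t * (\<Sum>i<Suc m. z i * A i j)" for j
      by (simp add: c_def algebra_simps sum.distrib sum_distrib_left)
    then have "(\<Sum>i<Suc m. c i * A i j) = f j" if "j < Suc m" for j
      using that u z_row False by (auto simp: less_Suc_eq s_def[symmetric] t_def simp del: sum.lessThan_Suc)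
    then show ?thesis by blast
  qed
qed

definition linear_combinations :: "nat \<Rightarrow> (nat \<Rightarrow> real^3 \<Rightarrow> real^3) \<Rightarrow> (real^3 \<Rightarrow> real^3) set" where
  "linear_combinations m b = {\<lambda>x. \<Sum>i<m. c i *\<^sub>R b i x | c. True}"

lemma linear_combinationsI: "(\<lambda>x. \<Sum>i<m. c i *\<^sub>R b i x) \<in> linear_combinations m b"
  unfolding linear_combinations_def by blast

lemma linear_combinations_basis:
  assumes "k < m" shows "b k \<in> linear_combinations m b"
proof -
  have "b k = (\<lambda>x. \<Sum>i<m. (if i = k then 1 else 0) *\<^sub>R b i x)"
    using assms by (simp add: if_distrib[of "\<lambda>r. r *\<^sub>R _"] cong: if_cong)
  also have "\<dots> \<in> linear_combinations m b" by (rule linear_combinationsI)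
  finally show ?thesis .
qed

lemma linear_combinations_partial_sum:
  assumes "k \<le> m" shows "(\<lambda>x. \<Sum>i<k. c i *\<^sub>R b i x) \<in> linear_combinations m b"
proof -
  have "(\<lambda>x. \<Sum>i<k. c i *\<^sub>R b i x) = (\<lambda>x. \<Sum>i<m. (if i < k then c i else 0) *\<^sub>R b i x)"
    using assms by (intro ext sum.mono_neutral_cong_left) auto
  also have "\<dots> \<in> linear_combinations m b" by (rule linear_combinationsI)
  finally show ?thesis .
qed

lemma linear_combinations_lincomb:
  assumes "u \<in> linear_combinations m b" "v \<in> linear_combinations m b"
  shows "(\<lambda>x. s *\<^sub>R u x + t *\<^sub>R v x) \<in> linear_combinations m b"
proof -
  obtain c d where "u = (\<lambda>x. \<Sum>i<m. c i *\<^sub>R b i x)" "v = (\<lambda>x. \<Sum>i<m. d i *\<^sub>R b i x)"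
    using assms by (auto simp: linear_combinations_def)
  then have "(\<lambda>x. s *\<^sub>R u x + t *\<^sub>R v x) = (\<lambda>x. \<Sum>i<m. (s * c i + t * d i) *\<^sub>R b i x)"
    by (simp add: scaleR_sum_right scaleR_add_left sum.distrib)
  then show ?thesis using linear_combinationsI[where c = "\<lambda>i. s * c i + t * d i"] by simp
qed

lemma linear_on_combinations:
  fixes G :: "(real^3 \<Rightarrow> real^3) \<Rightarrow> real"
  assumes lin: "\<And>s t u v. u \<in> linear_combinations m b \<Longrightarrow> v \<in> linear_combinations m b \<Longrightarrow>
      G (\<lambda>x. s *\<^sub>R u x + t *\<^sub>R v x) = s * G u + t * G v"
  shows "G (\<lambda>x. \<Sum>i<m. c i *\<^sub>R b i x) = (\<Sum>i<m. c i * G (b i))"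
proof -
  note partial = linear_combinations_partial_sum
  have "k \<le> m \<Longrightarrow> G (\<lambda>x. \<Sum>i<k. c i *\<^sub>R b i x) = (\<Sum>i<k. c i * G (b i))" for k
  proof (induction k)
    case 0
    show ?case using lin[OF partial[of 0 m c b] partial[of 0 m c b], of 0 0] by simp
  next
    case (Suc k)
    then show ?case
      using lin[OF partial[of k m c b] linear_combinations_basis[of k m b], of 1 "c k"] by simp
  qed
  then show ?thesis by simp
qed

lemma DC_functional_lincomb:
  assumes G: "DC_functional \<Omega> (linear_combinations m b) G"
    and u: "u \<in> linear_combinations m b" and v: "v \<in> linear_combinations m b"
  shows "G (\<lambda>x. s *\<^sub>R u x + t *\<^sub>R v x) = s * G u + t * G v"
proof -
  have "(\<lambda>x. s *\<^sub>R u x) \<in> linear_combinations m b" "(\<lambda>x. t *\<^sub>R v x) \<in> linear_combinations m b"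
    using linear_combinations_lincomb[OF u u, of s 0] linear_combinations_lincomb[OF v v, of t 0]
    by simp_all
  then have "G (\<lambda>x. s *\<^sub>R u x + t *\<^sub>R v x) = G (\<lambda>x. s *\<^sub>R u x) + G (\<lambda>x. t *\<^sub>R v x)"
    using G by (simp add: DC_functional_def)
  then show ?thesis using G u v by (simp add: DC_functional_def)
qed

lemma dual_norm_bdd_above:
  assumes "DC_functional \<Omega> V G"
  shows "bdd_above (insert 0 {\<bar>G v\<bar> / DC_norm \<Omega> v | v. v \<in> V \<and> \<not> (AE x in lebesgue_on \<Omega>. v x = 0)})"
proof -
  obtain B where B: "\<forall>v\<in>V. \<bar>G v\<bar> \<le> B * DC_norm \<Omega> v"
    using assms unfolding DC_functional_def by blast
  have "\<bar>G v\<bar> / DC_norm \<Omega> v \<le> max B 0" if "v \<in> V" for v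
    using B[rule_format, OF that] DC_norm_nonneg[of \<Omega> v]
    by (cases "DC_norm \<Omega> v = 0") (auto simp: divide_le_eq le_max_iff_disj)
  then show ?thesis by (intro bdd_aboveI[of _ "max B 0"]) auto
qed

lemma dual_norm_nonneg: "DC_functional \<Omega> V G \<Longrightarrow> 0 \<le> dual_norm \<Omega> V G"
  unfolding dual_norm_def by (rule cSup_upper[OF _ dual_norm_bdd_above]) auto

lemma dual_norm_upper:
  assumes "DC_functional \<Omega> V G" "v \<in> V" "\<not> (AE x in lebesgue_on \<Omega>. v x = 0)"
  shows "\<bar>G v\<bar> / DC_norm \<Omega> v \<le> dual_norm \<Omega> V G"
  unfolding dual_norm_def by (rule cSup_upper[OF _ dual_norm_bdd_above]) (use assms in auto)

text \<open>
  The norm does not see null sets, so uniqueness holds up to null sets. The assumption \<open>null\<close> says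
  that \<open>a\<close> descends to the quotient by null fields, where finite dimension makes it continuous.
\<close>

lemma coercive_problem_well_posed:
  assumes \<Omega>: "open \<Omega>" "bounded \<Omega>" and V: "finite_dim_space V" "V \<subseteq> H_div_curl \<Omega>"
    and lin1: "\<And>s t u v w. u \<in> V \<Longrightarrow> v \<in> V \<Longrightarrow> w \<in> V \<Longrightarrow>
      a (\<lambda>x. s *\<^sub>R u x + t *\<^sub>R v x) w = s * a u w + t * a v w"
    and lin2: "\<And>s t u v w. u \<in> V \<Longrightarrow> v \<in> V \<Longrightarrow> w \<in> V \<Longrightarrow>
      a w (\<lambda>x. s *\<^sub>R u x + t *\<^sub>R v x) = s * a w u + t * a w v"
    and null: "\<And>u v. u \<in> V \<Longrightarrow> v \<in> V \<Longrightarrow> DC_norm \<Omega> v = 0 \<Longrightarrow> a u v = 0"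
    and coercive: "\<gamma> > 0" "\<And>v. v \<in> V \<Longrightarrow> \<gamma> * (DC_norm \<Omega> v)\<^sup>2 \<le> a v v"
    and F: "DC_functional \<Omega> V F"
  shows "well_posed \<Omega> V a F"
proof -
  obtain m b where Vmb: "V = linear_combinations m b"
    using V(1) by (auto simp: finite_dim_space_def linear_combinations_def)
  have definite: "DC_norm \<Omega> v = 0" if "v \<in> V" "a v v = 0" for v
    using coercive(1) coercive(2)[OF that(1)] that(2)
    by (simp add: mult_le_0_iff)
  have b: "b i \<in> V" if "i < m" for i unfolding Vmb using that by (rule linear_combinations_basis)
  let ?comb = "\<lambda>c x. \<Sum>i<m. c i *\<^sub>R b i x"
  have comb: "?comb c \<in> V" for c unfolding Vmb by (rule linear_combinationsI)
  have F_comb: "F (?comb c) = (\<Sum>i<m. c i * F (b i))" for c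
    by (rule linear_on_combinations, rule DC_functional_lincomb[OF F[unfolded Vmb]])
  have a_comb1: "a (?comb c) v = (\<Sum>i<m. c i * a (b i) v)" if "v \<in> V" for c v
    by (rule linear_on_combinations) (use lin1 that Vmb in auto)
  have a_comb2: "a v (?comb c) = (\<Sum>i<m. c i * a v (b i))" if "v \<in> V" for c v
    by (rule linear_on_combinations) (use lin2 that Vmb in auto)
  obtain B where B: "\<forall>v\<in>V. \<bar>F v\<bar> \<le> B * DC_norm \<Omega> v"
    using F unfolding DC_functional_def by blast
  have "(\<forall>j<m. (\<Sum>i<m. c i * a (b j) (b i)) = 0) \<and> (\<Sum>j<m. c j * F (b j)) = 0"
    if "(\<Sum>i<m. \<Sum>j<m. c i * c j * a (b i) (b j)) = 0" for c
  proof -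
    have "a (?comb c) (?comb c) = (\<Sum>i<m. c i * (\<Sum>j<m. c j * a (b i) (b j)))"
      using a_comb1[OF comb] a_comb2[OF b] by simp
    also have "\<dots> = 0" using that by (simp add: sum_distrib_left mult_ac)
    finally have N: "DC_norm \<Omega> (?comb c) = 0" by (rule definite[OF comb])
    have "(\<Sum>i<m. c i * a (b j) (b i)) = 0" if "j < m" for j
      using null[OF b[OF that] comb N] a_comb2[OF b[OF that]] by simp
    moreover have "F (?comb c) = 0" using B[THEN bspec, OF comb[of c]] by (simp add: N)
    ultimately show ?thesis unfolding F_comb by simp
  qed
  from semidefinite_system_solvable[where m = m and A = "\<lambda>i j. a (b i) (b j)" and f = "\<lambda>j. F (b j)", OF this]
  obtain c where c: "\<And>j. j < m \<Longrightarrow> (\<Sum>i<m. c i * a (b i) (b j)) = F (b j)" by blast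
  have sol: "solution V a F (?comb c)"
    unfolding solution_def
  proof (intro conjI ballI comb)
    fix v assume "v \<in> V"
    then obtain d where v: "v = ?comb d" unfolding Vmb linear_combinations_def by blast
    have "a (?comb c) (?comb d) = (\<Sum>j<m. d j * a (?comb c) (b j))" by (rule a_comb2[OF comb])
    also have "\<dots> = (\<Sum>j<m. d j * F (b j))" using a_comb1[OF b] c by simp
    finally show "a (?comb c) v = F v" unfolding v F_comb .
  qed
  have unique: "AE x in lebesgue_on \<Omega>. w x = u x"
    if u: "solution V a F u" and w: "solution V a F w" for u w
  proof -
    let ?e = "\<lambda>x. 1 *\<^sub>R w x + (- 1) *\<^sub>R u x"
    have uw: "u \<in> V" "w \<in> V" using u w by (auto simp: solution_def)
    then have e: "?e \<in> V" unfolding Vmb by (intro linear_combinations_lincomb)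
    have "a ?e ?e = 0" unfolding lin1[OF uw(2,1) e] using u w e by (simp add: solution_def)
    then have "DC_norm \<Omega> ?e = 0" by (rule definite[OF e])
    then have "AE x in lebesgue_on \<Omega>. ?e x = 0"
      using DC_norm_eq_0_iff(1)[OF \<Omega> subsetD[OF V(2) e]] by simp
    then show ?thesis by eventually_elim simp
  qed
  have stable: "DC_norm \<Omega> u \<le> (1 / \<gamma>) * dual_norm \<Omega> V G"
    if G: "DC_functional \<Omega> V G" and u: "solution V a G u" for G u
  proof (cases "DC_norm \<Omega> u = 0")
    case True
    then show ?thesis using dual_norm_nonneg[OF G] coercive(1) by simp
  next
    case False
    let ?N = "DC_norm \<Omega> u"
    have N: "?N > 0" using False DC_norm_nonneg[of \<Omega> u] by simp
    have uV: "u \<in> V" using u by (simp add: solution_def)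
    then have "\<not> (AE x in lebesgue_on \<Omega>. u x = 0)"
      using False DC_norm_eq_0_iff(1)[OF \<Omega> subsetD[OF V(2)]] by blast
    from dual_norm_upper[OF G uV this] have G_le: "\<bar>G u\<bar> \<le> dual_norm \<Omega> V G * ?N"
      using N by (simp add: divide_le_eq)
    have "\<gamma> * ?N\<^sup>2 \<le> a u u" by (rule coercive(2)[OF uV])
    also have "a u u = G u" using u uV by (simp add: solution_def)
    also have "\<dots> \<le> dual_norm \<Omega> V G * ?N" using G_le by simp
    finally have "(\<gamma> * ?N) * ?N \<le> dual_norm \<Omega> V G * ?N" by (simp add: power2_eq_square mult.assoc)
    then have "\<gamma> * ?N \<le> dual_norm \<Omega> V G" using N by simp
    then show ?thesis using coercive(1) by (simp add: field_simps)
  qed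
  show ?thesis
    unfolding well_posed_def
  proof (intro conjI exI allI impI)
    show "AE x in lebesgue_on \<Omega>. w x = ?comb c x" if "solution V a F w" for w
      by (rule unique[OF sol that])
    show "DC_norm \<Omega> u \<le> 1 / \<gamma> * dual_norm \<Omega> V G"
      if "DC_functional \<Omega> V G" "solution V a G u" for G u
      by (rule stable[OF that])
  qed (rule F sol)+
qed

section \<open>The forms as integrals of pointwise forms in jets\<close>

lemma L2_inner_jet_lincomb:
  assumes \<Omega>: "open \<Omega>" "bounded \<Omega>" and v: "v \<in> H_div_curl \<Omega>" "w \<in> H_div_curl \<Omega>"
    and r: "r \<in> L2_space \<Omega>"
  shows "L2_inner \<Omega> (jet \<Omega> (\<lambda>x. s *\<^sub>R v x + t *\<^sub>R w x)) r =
    s * L2_inner \<Omega> (jet \<Omega> v) r + t * L2_inner \<Omega> (jet \<Omega> w) r"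
proof -
  note J = jet_in_L2_space[OF v(1)] jet_in_L2_space[OF v(2)]
  have "L2_inner \<Omega> (jet \<Omega> (\<lambda>x. s *\<^sub>R v x + t *\<^sub>R w x)) r =
      L2_inner \<Omega> (\<lambda>x. s *\<^sub>R jet \<Omega> v x + t *\<^sub>R jet \<Omega> w x) r"
    by (intro L2_inner_cong_AE L2_space_measurable jet_in_L2_space H_div_curl_lincomb
        L2_space_lincomb jet_lincomb \<Omega> v r)
  also have "\<dots> = s * L2_inner \<Omega> (jet \<Omega> v) r + t * L2_inner \<Omega> (jet \<Omega> w) r"
    by (rule L2_inner_lincomb[OF J r])
  finally show ?thesis .
qed

lemma L2_inner_jet_null:
  assumes \<Omega>: "open \<Omega>" "bounded \<Omega>" and v: "v \<in> H_div_curl \<Omega>" and "DC_norm \<Omega> v = 0"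
  shows "L2_inner \<Omega> (jet \<Omega> v) r = 0"
proof -
  have "AE x in lebesgue_on \<Omega>. jet \<Omega> v x = 0" using DC_norm_eq_0_iff(2)[OF \<Omega> v] assms(4) by simp
  then have "AE x in lebesgue_on \<Omega>. jet \<Omega> v x \<bullet> r x = 0" by eventually_elim simp
  then show ?thesis unfolding L2_inner_def by (rule integral_eq_zero_AE)
qed

text \<open>
  A Cauchy--Schwarz inequality with a cruder constant, from
  \<open>p q \<le> N q\<^sup>2 / 2 + p\<^sup>2 / (2 N)\<close> for the pointwise norms \<open>p\<close> of the jet and \<open>q\<close> of \<open>r\<close>, with
  \<open>N\<close> the norm of \<open>v\<close>.
\<close>

lemma L2_inner_jet_bound:
  assumes \<Omega>: "open \<Omega>" "bounded \<Omega>" and v: "v \<in> H_div_curl \<Omega>" and r: "r \<in> L2_space \<Omega>"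
  shows "\<bar>L2_inner \<Omega> (jet \<Omega> v) r\<bar> \<le> ((L2_norm \<Omega> r)\<^sup>2 + 1) / 2 * DC_norm \<Omega> v"
proof (cases "DC_norm \<Omega> v = 0")
  case True
  then show ?thesis using L2_inner_jet_null[OF \<Omega> v] by simp
next
  case False
  define N where "N = DC_norm \<Omega> v"
  have N: "N > 0" using False DC_norm_nonneg[of \<Omega> v] by (simp add: N_def)
  note J = jet_in_L2_space[OF v]
  have int: "integrable (lebesgue_on \<Omega>) (\<lambda>x. (norm (jet \<Omega> v x))\<^sup>2)"
    "integrable (lebesgue_on \<Omega>) (\<lambda>x. (norm (r x))\<^sup>2)"
    using J r by (auto simp: L2_space_def)
  have pointwise: "\<bar>jet \<Omega> v x \<bullet> r x\<bar> \<le> N / 2 * (norm (r x))\<^sup>2 + 1 / (2 * N) * (norm (jet \<Omega> v x))\<^sup>2" for x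
  proof -
    have "0 \<le> (N * norm (r x) - norm (jet \<Omega> v x))\<^sup>2 / (2 * N)" using N by simp
    also have "\<dots> = N / 2 * (norm (r x))\<^sup>2 + 1 / (2 * N) * (norm (jet \<Omega> v x))\<^sup>2 -
        norm (jet \<Omega> v x) * norm (r x)"
      using N by (simp add: field_simps power2_eq_square)
    finally show ?thesis using Cauchy_Schwarz_ineq2[of "jet \<Omega> v x" "r x"] by linarith
  qed
  have "\<bar>L2_inner \<Omega> (jet \<Omega> v) r\<bar> \<le> (\<integral>x. \<bar>jet \<Omega> v x \<bullet> r x\<bar> \<partial>lebesgue_on \<Omega>)"
    unfolding L2_inner_def by (rule integral_abs_bound)
  also have "\<dots> \<le> (\<integral>x. N / 2 * (norm (r x))\<^sup>2 + 1 / (2 * N) * (norm (jet \<Omega> v x))\<^sup>2 \<partial>lebesgue_on \<Omega>)"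
    by (intro integral_mono integrable_abs integrable_L2_inner[OF J r] pointwise) (use int in auto)
  also have "\<dots> = N / 2 * (L2_norm \<Omega> r)\<^sup>2 + 1 / (2 * N) * N\<^sup>2"
    using int by (simp add: L2_norm_power2 N_def DC_norm_eq_jet[OF v])
  also have "\<dots> = ((L2_norm \<Omega> r)\<^sup>2 + 1) / 2 * N" using N by (simp add: field_simps power2_eq_square)
  finally show ?thesis by (simp add: N_def)
qed

lemma DC_functional_L2_inner_jet:
  assumes \<Omega>: "open \<Omega>" "bounded \<Omega>" and V: "V \<subseteq> H_div_curl \<Omega>" and r: "r \<in> L2_space \<Omega>"
  shows "DC_functional \<Omega> V (\<lambda>v. L2_inner \<Omega> (jet \<Omega> v) r)"
  unfolding DC_functional_def
proof (intro conjI ballI allI exI)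
  fix u v assume "u \<in> V" "v \<in> V"
  then show "L2_inner \<Omega> (jet \<Omega> (\<lambda>x. u x + v x)) r = L2_inner \<Omega> (jet \<Omega> u) r + L2_inner \<Omega> (jet \<Omega> v) r"
    using L2_inner_jet_lincomb[OF \<Omega> _ _ r, of u v 1 1] V by auto
next
  fix c v assume "v \<in> V"
  then show "L2_inner \<Omega> (jet \<Omega> (\<lambda>x. c *\<^sub>R v x)) r = c * L2_inner \<Omega> (jet \<Omega> v) r"
    using L2_inner_jet_lincomb[OF \<Omega> _ _ r, of v v c 0] V by auto
next
  fix v assume "v \<in> V"
  then show "\<bar>L2_inner \<Omega> (jet \<Omega> v) r\<bar> \<le> ((L2_norm \<Omega> r)\<^sup>2 + 1) / 2 * DC_norm \<Omega> v"
    using L2_inner_jet_bound[OF \<Omega> _ r] V by auto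
qed

lemma Z_mat_mult: "Z_mat \<kappa> n *v w = w - ((1 - \<kappa>) * (n \<bullet> w)) *\<^sub>R n"
proof -
  have outer: "(\<chi> i j. n $ i * n $ j) *v w = (n \<bullet> w) *\<^sub>R n"
    by (simp add: vec_eq_iff matrix_vector_mult_def inner_vec_def sum_distrib_left sum_distrib_right mult_ac)
  show ?thesis
    unfolding Z_mat_def matrix_vector_mult_diff_rdistrib scaleR_matrix_vector_assoc[symmetric] outer
    by simp
qed

lemma Z_mat_inner: "(Z_mat \<kappa> n *v w) \<bullet> w' = w \<bullet> w' - (1 - \<kappa>) * ((n \<bullet> w) * (n \<bullet> w'))"
  by (simp add: Z_mat_mult inner_diff_left)

text \<open>
  The pointwise bilinear integrands of \<open>\<hat>a\<close> and \<open>a\<close> and the linear integrand of \<open>F\<close>, represented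
  by the vectors with which the jet of the test function is paired. Here \<open>c\<close> stands for the curl
  of \<open>n\<close>.
\<close>

definition flux_hat ::
  "real \<Rightarrow> real \<Rightarrow> real \<Rightarrow> real^3 \<Rightarrow> real^3 \<Rightarrow>
   (real^3) \<times> real \<times> (real^3) \<Rightarrow> (real^3) \<times> real \<times> (real^3)" where
  "flux_hat K1 K2 K3 n c p =
    (let u = fst p; du = fst (snd p); cu = snd (snd p) in
     ((K2 - K3) *\<^sub>R ((n \<bullet> c) *\<^sub>R cu + (n \<bullet> cu) *\<^sub>R c + (u \<bullet> c) *\<^sub>R c),
      K1 * du,
      K3 *\<^sub>R (cu - ((1 - K2 / K3) * (n \<bullet> cu)) *\<^sub>R n) + (K2 - K3) *\<^sub>R ((n \<bullet> c) *\<^sub>R u + (u \<bullet> c) *\<^sub>R n)))"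

definition flux ::
  "real \<Rightarrow> real \<Rightarrow> real \<Rightarrow> real \<Rightarrow> real^3 \<Rightarrow> real^3 \<Rightarrow>
   (real^3) \<times> real \<times> (real^3) \<Rightarrow> (real^3) \<times> real \<times> (real^3)" where
  "flux K1 K2 K3 \<zeta> n c p = flux_hat K1 K2 K3 n c p +
    ((2 * \<zeta>) *\<^sub>R ((n \<bullet> n - 1) *\<^sub>R fst p + (2 * (fst p \<bullet> n)) *\<^sub>R n), 0, 0)"

definition residual ::
  "real \<Rightarrow> real \<Rightarrow> real \<Rightarrow> real \<Rightarrow> (real^3) \<times> real \<times> (real^3) \<Rightarrow> (real^3) \<times> real \<times> (real^3)" where
  "residual K1 K2 K3 \<zeta> p =
    (let n = fst p; dn = fst (snd p); c = snd (snd p) in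
     (- 1) *\<^sub>R (((K2 - K3) * (n \<bullet> c)) *\<^sub>R c + (2 * \<zeta> * (n \<bullet> n - 1)) *\<^sub>R n,
      K1 * dn,
      K3 *\<^sub>R (c - ((1 - K2 / K3) * (n \<bullet> c)) *\<^sub>R n)))"

lemma flux_hat_inner:
  "(v, dv, cv) \<bullet> flux_hat K1 K2 K3 n c (u, du, cu) =
    K1 * (du * dv) + K3 * (cu \<bullet> cv - (1 - K2 / K3) * ((n \<bullet> cu) * (n \<bullet> cv))) +
    (K2 - K3) * ((u \<bullet> cv) * (n \<bullet> c) + (n \<bullet> cv) * (u \<bullet> c) + (n \<bullet> c) * (v \<bullet> cu) +
      (n \<bullet> cu) * (v \<bullet> c) + (u \<bullet> c) * (v \<bullet> c))"
  by (simp add: flux_hat_def inner_prod_def inner_add_right inner_diff_right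
      inner_commute algebra_simps)

lemma residual_inner:
  "(v, dv, cv) \<bullet> residual K1 K2 K3 \<zeta> (n, dn, c) =
    - (K1 * (dn * dv) + K3 * (c \<bullet> cv - (1 - K2 / K3) * ((n \<bullet> c) * (n \<bullet> cv))) +
      (K2 - K3) * ((n \<bullet> c) * (v \<bullet> c)) + 2 * \<zeta> * ((v \<bullet> n) * (n \<bullet> n - 1)))"
  by (simp add: residual_def inner_prod_def inner_add_right inner_diff_right
      inner_commute algebra_simps)

lemma flux_hat_symmetric: "q \<bullet> flux_hat K1 K2 K3 n c p = p \<bullet> flux_hat K1 K2 K3 n c q"
  by (cases p, cases q) (simp add: flux_hat_inner inner_commute algebra_simps)

lemma flux_symmetric: "q \<bullet> flux K1 K2 K3 \<zeta> n c p = p \<bullet> flux K1 K2 K3 \<zeta> n c q"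
  using flux_hat_symmetric[of q K1 K2 K3 n c p]
  by (simp add: flux_def inner_prod_def inner_simps inner_commute algebra_simps)

text \<open>
  In this class all products occurring in the forms are bounded, hence integrable on a bounded
  domain. It contains the finite-element fields that have a weak divergence and curl.
\<close>

definition bounded_jets :: "(real^3) set \<Rightarrow> (real^3 \<Rightarrow> real^3) set" where
  "bounded_jets \<Omega> = {v \<in> H_div_curl \<Omega>. jet \<Omega> v \<in> Linfty \<Omega>}"

lemma bounded_jetsD:
  assumes "v \<in> bounded_jets \<Omega>"
  shows "v \<in> H_div_curl \<Omega>" "jet \<Omega> v \<in> Linfty \<Omega>" "v \<in> Linfty \<Omega>" "wdiv \<Omega> v \<in> Linfty \<Omega>"
    "wcurl \<Omega> v \<in> Linfty \<Omega>"
  using assms Linfty_fst[of "jet \<Omega> v" \<Omega>] Linfty_fst[OF Linfty_snd[of "jet \<Omega> v" \<Omega>]]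
    Linfty_snd[OF Linfty_snd[of "jet \<Omega> v" \<Omega>]]
  by (simp_all add: bounded_jets_def jet_def)

lemma flux_hat_Linfty:
  assumes "n \<in> Linfty \<Omega>" "c \<in> Linfty \<Omega>" "p \<in> Linfty \<Omega>"
  shows "(\<lambda>x. flux_hat K1 K2 K3 (n x) (c x) (p x)) \<in> Linfty \<Omega>"
  unfolding flux_hat_def Let_def by (intro Linfty_intros assms)

lemma flux_Linfty:
  assumes "n \<in> Linfty \<Omega>" "c \<in> Linfty \<Omega>" "p \<in> Linfty \<Omega>"
  shows "(\<lambda>x. flux K1 K2 K3 \<zeta> (n x) (c x) (p x)) \<in> Linfty \<Omega>"
  unfolding flux_def by (intro Linfty_intros flux_hat_Linfty assms)

lemma residual_Linfty:
  assumes "p \<in> Linfty \<Omega>"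
  shows "(\<lambda>x. residual K1 K2 K3 \<zeta> (p x)) \<in> Linfty \<Omega>"
  unfolding residual_def Let_def by (intro Linfty_intros assms)

lemma a_hat_eq_flux:
  assumes \<Omega>: "open \<Omega>" "bounded \<Omega>" and n: "n \<in> bounded_jets \<Omega>"
    and u: "u \<in> bounded_jets \<Omega>" and v: "v \<in> bounded_jets \<Omega>"
  shows "a_hat \<Omega> K1 K2 K3 n u v =
    L2_inner \<Omega> (jet \<Omega> v) (\<lambda>x. flux_hat K1 K2 K3 (n x) (wcurl \<Omega> n x) (jet \<Omega> u x))"
proof -
  let ?c = "wcurl \<Omega> n" and ?M = "lebesgue_on \<Omega>"
  define T1 where "T1 x = wdiv \<Omega> u x * wdiv \<Omega> v x" for x
  define T2 where "T2 x = wcurl \<Omega> u x \<bullet> wcurl \<Omega> v x" for x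
  define T3 where "T3 x = (n x \<bullet> wcurl \<Omega> u x) * (n x \<bullet> wcurl \<Omega> v x)" for x
  define T4 where "T4 x = (u x \<bullet> wcurl \<Omega> v x) * (n x \<bullet> ?c x)" for x
  define T5 where "T5 x = (n x \<bullet> wcurl \<Omega> v x) * (u x \<bullet> ?c x)" for x
  define T6 where "T6 x = (n x \<bullet> ?c x) * (v x \<bullet> wcurl \<Omega> u x)" for x
  define T7 where "T7 x = (n x \<bullet> wcurl \<Omega> u x) * (v x \<bullet> ?c x)" for x
  define T8 where "T8 x = (u x \<bullet> ?c x) * (v x \<bullet> ?c x)" for x
  note defs = T1_def T2_def T3_def T4_def T5_def T6_def T7_def T8_def
  have int [simp]: "integrable ?M T1" "integrable ?M T2" "integrable ?M T3" "integrable ?M T4"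
    "integrable ?M T5" "integrable ?M T6" "integrable ?M T7" "integrable ?M T8"
    unfolding defs[abs_def]
    by (intro integrable_Linfty[OF \<Omega>] Linfty_intros bounded_jetsD[OF n] bounded_jetsD[OF u] bounded_jetsD[OF v])+
  have flux: "jet \<Omega> v x \<bullet> flux_hat K1 K2 K3 (n x) (?c x) (jet \<Omega> u x) =
      K1 * T1 x + K3 * (T2 x - (1 - K2 / K3) * T3 x) + (K2 - K3) * (T4 x + T5 x + T6 x + T7 x + T8 x)" for x
    unfolding jet_def flux_hat_inner defs ..
  have Z: "(Z_mat (K2 / K3) (n x) *v wcurl \<Omega> u x) \<bullet> wcurl \<Omega> v x = T2 x - (1 - K2 / K3) * T3 x" for x
    unfolding Z_mat_inner defs ..
  have "a_hat \<Omega> K1 K2 K3 n u v = K1 * (\<integral>x. T1 x \<partial>?M) +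
      K3 * (\<integral>x. T2 x - (1 - K2 / K3) * T3 x \<partial>?M) + (K2 - K3) * ((\<integral>x. T4 x \<partial>?M) +
      (\<integral>x. T5 x \<partial>?M) + (\<integral>x. T6 x \<partial>?M) + (\<integral>x. T7 x \<partial>?M) + (\<integral>x. T8 x \<partial>?M))"
    unfolding a_hat_def L2_inner_def Z unfolding inner_real_def defs ..
  also have "\<dots> = (\<integral>x. K1 * T1 x + K3 * (T2 x - (1 - K2 / K3) * T3 x) +
      (K2 - K3) * (T4 x + T5 x + T6 x + T7 x + T8 x) \<partial>?M)"
    by simp
  finally show ?thesis unfolding L2_inner_def flux .
qed

lemma a_form_eq_flux:
  assumes \<Omega>: "open \<Omega>" "bounded \<Omega>" and n: "n \<in> bounded_jets \<Omega>"
    and u: "u \<in> bounded_jets \<Omega>" and v: "v \<in> bounded_jets \<Omega>"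
  shows "a_form \<Omega> K1 K2 K3 \<zeta> n u v =
    L2_inner \<Omega> (jet \<Omega> v) (\<lambda>x. flux K1 K2 K3 \<zeta> (n x) (wcurl \<Omega> n x) (jet \<Omega> u x))"
proof -
  let ?c = "wcurl \<Omega> n" and ?M = "lebesgue_on \<Omega>"
  define T0 where "T0 x = jet \<Omega> v x \<bullet> flux_hat K1 K2 K3 (n x) (?c x) (jet \<Omega> u x)" for x
  define T1 where "T1 x = (n x \<bullet> n x - 1) * (v x \<bullet> u x)" for x
  define T2 where "T2 x = (u x \<bullet> n x) * (v x \<bullet> n x)" for x
  note defs = T0_def T1_def T2_def
  have int [simp]: "integrable ?M T0" "integrable ?M T1" "integrable ?M T2"
    unfolding defs[abs_def]
    by (intro integrable_Linfty[OF \<Omega>] flux_hat_Linfty Linfty_intros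
        bounded_jetsD[OF n] bounded_jetsD[OF u] bounded_jetsD[OF v])+
  have flux: "jet \<Omega> v x \<bullet> flux K1 K2 K3 \<zeta> (n x) (?c x) (jet \<Omega> u x) =
      T0 x + 2 * \<zeta> * (T1 x + 2 * T2 x)" for x
    by (simp add: flux_def jet_def inner_prod_def inner_simps inner_commute defs algebra_simps)
  have "a_form \<Omega> K1 K2 K3 \<zeta> n u v =
      (\<integral>x. T0 x \<partial>?M) + 2 * \<zeta> * ((\<integral>x. T1 x \<partial>?M) + 2 * (\<integral>x. T2 x \<partial>?M))"
    unfolding a_form_def a_hat_eq_flux[OF assms] L2_inner_def unfolding inner_real_def defs ..
  also have "\<dots> = (\<integral>x. T0 x + 2 * \<zeta> * (T1 x + 2 * T2 x) \<partial>?M)" by simp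
  finally show ?thesis unfolding L2_inner_def flux .
qed

lemma F_form_eq_residual:
  assumes \<Omega>: "open \<Omega>" "bounded \<Omega>" and n: "n \<in> bounded_jets \<Omega>" and v: "v \<in> bounded_jets \<Omega>"
  shows "F_form \<Omega> K1 K2 K3 \<zeta> n v = L2_inner \<Omega> (jet \<Omega> v) (\<lambda>x. residual K1 K2 K3 \<zeta> (jet \<Omega> n x))"
proof -
  let ?c = "wcurl \<Omega> n" and ?M = "lebesgue_on \<Omega>"
  define T1 where "T1 x = wdiv \<Omega> n x * wdiv \<Omega> v x" for x
  define T2 where "T2 x = ?c x \<bullet> wcurl \<Omega> v x" for x
  define T3 where "T3 x = (n x \<bullet> ?c x) * (n x \<bullet> wcurl \<Omega> v x)" for x
  define T4 where "T4 x = (n x \<bullet> ?c x) * (v x \<bullet> ?c x)" for x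
  define T5 where "T5 x = (v x \<bullet> n x) * (n x \<bullet> n x - 1)" for x
  note defs = T1_def T2_def T3_def T4_def T5_def
  have int [simp]: "integrable ?M T1" "integrable ?M T2" "integrable ?M T3" "integrable ?M T4"
    "integrable ?M T5"
    unfolding defs[abs_def]
    by (intro integrable_Linfty[OF \<Omega>] Linfty_intros bounded_jetsD[OF n] bounded_jetsD[OF v])+
  have residual: "jet \<Omega> v x \<bullet> residual K1 K2 K3 \<zeta> (jet \<Omega> n x) =
      - (K1 * T1 x + K3 * (T2 x - (1 - K2 / K3) * T3 x) + (K2 - K3) * T4 x + 2 * \<zeta> * T5 x)" for x
    unfolding jet_def residual_inner defs ..
  have Z: "(Z_mat (K2 / K3) (n x) *v ?c x) \<bullet> wcurl \<Omega> v x = T2 x - (1 - K2 / K3) * T3 x" for x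
    unfolding Z_mat_inner defs ..
  have "F_form \<Omega> K1 K2 K3 \<zeta> n v = - (K1 * (\<integral>x. T1 x \<partial>?M) +
      K3 * (\<integral>x. T2 x - (1 - K2 / K3) * T3 x \<partial>?M) + (K2 - K3) * (\<integral>x. T4 x \<partial>?M) +
      2 * \<zeta> * (\<integral>x. T5 x \<partial>?M))"
    unfolding F_form_def L2_inner_def Z unfolding inner_real_def defs ..
  also have "\<dots> = (\<integral>x. - (K1 * T1 x + K3 * (T2 x - (1 - K2 / K3) * T3 x) +
      (K2 - K3) * T4 x + 2 * \<zeta> * T5 x) \<partial>?M)"
    by simp
  finally show ?thesis unfolding L2_inner_def residual .
qed

section \<open>Well-posedness of the linearised problem\<close>

lemma finite_dim_space_lincomb:
  assumes "finite_dim_space V" "u \<in> V" "v \<in> V"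
  shows "(\<lambda>x. s *\<^sub>R u x + t *\<^sub>R v x) \<in> V"
proof -
  obtain m b where V: "V = linear_combinations m b"
    using assms(1) by (auto simp: finite_dim_space_def linear_combinations_def)
  show ?thesis using assms(2,3) unfolding V by (rule linear_combinations_lincomb)
qed

lemma a_form_symmetric:
  assumes \<Omega>: "open \<Omega>" "bounded \<Omega>" and n: "n \<in> bounded_jets \<Omega>"
    and u: "u \<in> bounded_jets \<Omega>" and v: "v \<in> bounded_jets \<Omega>"
  shows "a_form \<Omega> K1 K2 K3 \<zeta> n u v = a_form \<Omega> K1 K2 K3 \<zeta> n v u"
  unfolding a_form_eq_flux[OF \<Omega> n u v] a_form_eq_flux[OF \<Omega> n v u] L2_inner_def
  by (subst flux_symmetric) (rule refl)

lemma linearised_problem_well_posed: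
  assumes \<Omega>: "open \<Omega>" "bounded \<Omega>" and V: "finite_dim_space V" "V \<subseteq> bounded_jets \<Omega>"
    and n: "n \<in> bounded_jets \<Omega>"
    and coercive: "\<gamma> > 0" "\<And>v. v \<in> V \<Longrightarrow> \<gamma> * (DC_norm \<Omega> v)\<^sup>2 \<le> a_form \<Omega> K1 K2 K3 \<zeta> n v v"
  shows "well_posed \<Omega> V (a_form \<Omega> K1 K2 K3 \<zeta> n) (F_form \<Omega> K1 K2 K3 \<zeta> n)"
proof -
  let ?a = "a_form \<Omega> K1 K2 K3 \<zeta> n" and ?F = "F_form \<Omega> K1 K2 K3 \<zeta> n"
  let ?r = "\<lambda>x. residual K1 K2 K3 \<zeta> (jet \<Omega> n x)"
  note closed = finite_dim_space_lincomb[OF V(1)]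
  have bj: "v \<in> bounded_jets \<Omega>" if "v \<in> V" for v using V(2) that by blast
  have hdc: "v \<in> H_div_curl \<Omega>" if "v \<in> V" for v by (rule bounded_jetsD(1)[OF bj[OF that]])
  have flux_L2: "(\<lambda>x. flux K1 K2 K3 \<zeta> (n x) (wcurl \<Omega> n x) (jet \<Omega> u x)) \<in> L2_space \<Omega>" if "u \<in> V" for u
    by (intro Linfty_in_L2_space[OF \<Omega>] flux_Linfty bounded_jetsD[OF n] bounded_jetsD(2) bj that)
  have lin2: "?a w (\<lambda>x. s *\<^sub>R u x + t *\<^sub>R v x) = s * ?a w u + t * ?a w v"
    if "u \<in> V" "v \<in> V" "w \<in> V" for s t u v w
    using a_form_eq_flux[OF \<Omega> n bj bj] that closed L2_inner_jet_lincomb[OF \<Omega> hdc hdc flux_L2] by simp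
  have lin1: "?a (\<lambda>x. s *\<^sub>R u x + t *\<^sub>R v x) w = s * ?a u w + t * ?a v w"
    if "u \<in> V" "v \<in> V" "w \<in> V" for s t u v w
    using lin2[OF that] a_form_symmetric[OF \<Omega> n bj bj, of w] closed that by simp
  have null: "?a u v = 0" if "u \<in> V" "v \<in> V" "DC_norm \<Omega> v = 0" for u v
    unfolding a_form_eq_flux[OF \<Omega> n bj[OF that(1)] bj[OF that(2)]]
    by (rule L2_inner_jet_null[OF \<Omega> hdc[OF that(2)] that(3)])
  have F: "?F v = L2_inner \<Omega> (jet \<Omega> v) ?r" if "v \<in> V" for v
    by (rule F_form_eq_residual[OF \<Omega> n bj[OF that]])
  have "?r \<in> L2_space \<Omega>"
    by (intro Linfty_in_L2_space[OF \<Omega>] residual_Linfty bounded_jetsD[OF n])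
  from DC_functional_L2_inner_jet[OF \<Omega> _ this, of V]
  have G: "DC_functional \<Omega> V (\<lambda>v. L2_inner \<Omega> (jet \<Omega> v) ?r)" using hdc by blast
  have add: "(\<lambda>x. u x + v x) \<in> V" if "u \<in> V" "v \<in> V" for u v using closed[OF that, of 1 1] by simp
  have scale: "(\<lambda>x. c *\<^sub>R v x) \<in> V" if "v \<in> V" for c v using closed[OF that that, of c 0] by simp
  have DC_F: "DC_functional \<Omega> V ?F"
    using G unfolding DC_functional_def by (simp add: F add scale)
  have "V \<subseteq> H_div_curl \<Omega>" using hdc by blast
  from coercive_problem_well_posed[OF \<Omega> V(1) this lin1 lin2 null coercive DC_F]
  show ?thesis .
qed

lemma a_form_ge_a_hat:
  assumes \<Omega>: "open \<Omega>" "bounded \<Omega>" and n: "n \<in> bounded_jets \<Omega>" and v: "v \<in> bounded_jets \<Omega>"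
    and \<alpha>: "\<alpha> \<le> 1" "\<And>x. x \<in> \<Omega> \<Longrightarrow> \<alpha> \<le> (norm (n x))\<^sup>2" and \<zeta>: "\<zeta> \<ge> 0"
  shows "a_hat \<Omega> K1 K2 K3 n v v - 2 * \<zeta> * \<bar>\<alpha> - 1\<bar> * (DC_norm \<Omega> v)\<^sup>2 \<le> a_form \<Omega> K1 K2 K3 \<zeta> n v v"
proof -
  let ?M = "lebesgue_on \<Omega>"
  note L = bounded_jetsD[OF n] bounded_jetsD[OF v]
  have "- (1 - \<alpha>) * (DC_norm \<Omega> v)\<^sup>2 \<le> - (1 - \<alpha>) * (L2_norm \<Omega> v)\<^sup>2"
    using \<alpha>(1) by (intro mult_left_mono_neg) (auto simp: DC_norm_power2)
  also have "\<dots> = (\<integral>x. (\<alpha> - 1) * (v x \<bullet> v x) \<partial>?M)"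
    by (simp add: L2_norm_power2 power2_norm_eq_inner)
  also have "\<dots> \<le> (\<integral>x. (n x \<bullet> n x - 1) * (v x \<bullet> v x) \<partial>?M)"
  proof (rule integral_mono)
    show "integrable ?M (\<lambda>x. (\<alpha> - 1) * (v x \<bullet> v x))"
      "integrable ?M (\<lambda>x. (n x \<bullet> n x - 1) * (v x \<bullet> v x))"
      by (intro integrable_Linfty[OF \<Omega>] Linfty_intros L)+
    show "(\<alpha> - 1) * (v x \<bullet> v x) \<le> (n x \<bullet> n x - 1) * (v x \<bullet> v x)" if "x \<in> space ?M" for x
      using \<alpha>(2)[of x] that by (intro mult_right_mono) (auto simp: power2_norm_eq_inner)
  qed
  finally have 1: "- (1 - \<alpha>) * (DC_norm \<Omega> v)\<^sup>2 \<le> L2_inner \<Omega> (\<lambda>x. n x \<bullet> n x - 1) (\<lambda>x. v x \<bullet> v x)"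
    by (simp add: L2_inner_def)
  have 2: "0 \<le> L2_inner \<Omega> (\<lambda>x. v x \<bullet> n x) (\<lambda>x. v x \<bullet> n x)"
    unfolding L2_inner_def by (rule integral_nonneg_AE) auto
  have "2 * \<zeta> * (- (1 - \<alpha>) * (DC_norm \<Omega> v)\<^sup>2) \<le>
      2 * \<zeta> * (L2_inner \<Omega> (\<lambda>x. n x \<bullet> n x - 1) (\<lambda>x. v x \<bullet> v x) +
        2 * L2_inner \<Omega> (\<lambda>x. v x \<bullet> n x) (\<lambda>x. v x \<bullet> n x))"
    using 1 2 \<zeta> by (intro mult_left_mono) auto
  then show ?thesis using \<alpha>(1) by (simp add: a_form_def algebra_simps)
qed

text \<open>
  The quadratic form in \<open>v\<close> and \<open>w = curl v\<close> that \<open>K\<^sub>2 - K\<^sub>3\<close> multiplies in \<open>\<hat>a(v, v)\<close>; its first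
  term comes from \<open>Z\<close>.
\<close>

lemma frank_terms_bound:
  fixes n c v w :: "real^3"
  assumes n: "norm n \<le> B" and c: "norm c \<le> B"
  shows "\<bar>(n \<bullet> w)\<^sup>2 + 2 * ((v \<bullet> w) * (n \<bullet> c)) + 2 * ((n \<bullet> w) * (v \<bullet> c)) + (v \<bullet> c)\<^sup>2\<bar>
    \<le> 3 * B\<^sup>2 * ((norm v)\<^sup>2 + (norm w)\<^sup>2)"
proof -
  have B: "0 \<le> B" using n norm_ge_zero[of n] by linarith
  have nw: "\<bar>n \<bullet> w\<bar> \<le> B * norm w"
    using Cauchy_Schwarz_ineq2[of n w] mult_right_mono[OF n norm_ge_zero[of w]] by linarith
  have vc: "\<bar>v \<bullet> c\<bar> \<le> B * norm v"
    using Cauchy_Schwarz_ineq2[of v c] mult_left_mono[OF c norm_ge_zero[of v]]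
    by (simp add: mult.commute)
  have nc: "\<bar>n \<bullet> c\<bar> \<le> B * B"
    using Cauchy_Schwarz_ineq2[of n c] mult_mono[OF n c B norm_ge_zero] by linarith
  have "(n \<bullet> w)\<^sup>2 \<le> (B * norm w)\<^sup>2" "(v \<bullet> c)\<^sup>2 \<le> (B * norm v)\<^sup>2"
    using nw vc by (auto intro!: abs_le_square_iff[THEN iffD1] simp: B abs_mult)
  moreover have "\<bar>(v \<bullet> w) * (n \<bullet> c)\<bar> \<le> (norm v * norm w) * (B * B)"
    unfolding abs_mult by (intro mult_mono Cauchy_Schwarz_ineq2 nc) auto
  moreover have "\<bar>(n \<bullet> w) * (v \<bullet> c)\<bar> \<le> (B * norm w) * (B * norm v)"
    unfolding abs_mult using B by (intro mult_mono nw vc) auto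
  ultimately have "\<bar>(n \<bullet> w)\<^sup>2 + 2 * ((v \<bullet> w) * (n \<bullet> c)) + 2 * ((n \<bullet> w) * (v \<bullet> c)) + (v \<bullet> c)\<^sup>2\<bar>
      \<le> (B * norm w)\<^sup>2 + 2 * ((norm v * norm w) * (B * B)) +
        2 * ((B * norm w) * (B * norm v)) + (B * norm v)\<^sup>2"
    using zero_le_power2[of "n \<bullet> w"] zero_le_power2[of "v \<bullet> c"] by linarith
  also have "\<dots> = B\<^sup>2 * ((norm v)\<^sup>2 + (norm w)\<^sup>2 + 2 * (2 * norm v * norm w))"
    by (simp add: power2_eq_square algebra_simps)
  also have "\<dots> \<le> B\<^sup>2 * ((norm v)\<^sup>2 + (norm w)\<^sup>2 + 2 * ((norm v)\<^sup>2 + (norm w)\<^sup>2))"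
    using sum_squares_bound[of "norm v" "norm w"] by (intro mult_left_mono add_left_mono) auto
  finally show ?thesis by (simp add: algebra_simps)
qed

text \<open>
  Since \<open>K\<^sub>3 (1 - \<kappa>) = K\<^sub>3 - K\<^sub>2\<close>, the form \<open>\<hat>a\<close> is the one for equal constants \<open>K\<^sub>2 = K\<^sub>3\<close> plus
  \<open>K\<^sub>2 - K\<^sub>3\<close> times the terms bounded in
  \<open>frank_terms_bound\<close>.
\<close>

lemma a_hat_lower_bound:
  assumes \<Omega>: "open \<Omega>" "bounded \<Omega>" and n: "n \<in> bounded_jets \<Omega>" and v: "v \<in> bounded_jets \<Omega>"
    and B: "AE x in lebesgue_on \<Omega>. norm (n x) \<le> B" "AE x in lebesgue_on \<Omega>. norm (wcurl \<Omega> n x) \<le> B"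
    and K3: "K3 > 0"
  shows "min K1 K3 * ((L2_norm \<Omega> (wdiv \<Omega> v))\<^sup>2 + (L2_norm \<Omega> (wcurl \<Omega> v))\<^sup>2) -
    \<bar>K2 - K3\<bar> * (3 * B\<^sup>2) * (DC_norm \<Omega> v)\<^sup>2 \<le> a_hat \<Omega> K1 K2 K3 n v v"
proof -
  let ?M = "lebesgue_on \<Omega>" and ?d = "wdiv \<Omega> v" and ?w = "wcurl \<Omega> v" and ?c = "wcurl \<Omega> n"
  note L = bounded_jetsD[OF n] bounded_jetsD[OF v]
  have int: "integrable ?M (\<lambda>x. (norm (?d x))\<^sup>2)" "integrable ?M (\<lambda>x. (norm (?w x))\<^sup>2)"
    "integrable ?M (\<lambda>x. (norm (jet \<Omega> v x))\<^sup>2)"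
    using H_div_curlD(4,5)[OF L(6)] jet_in_L2_space[OF L(6)] by (auto simp: L2_space_def)
  have "min K1 K3 * ((L2_norm \<Omega> ?d)\<^sup>2 + (L2_norm \<Omega> ?w)\<^sup>2) - \<bar>K2 - K3\<bar> * (3 * B\<^sup>2) * (DC_norm \<Omega> v)\<^sup>2 =
      (\<integral>x. min K1 K3 * ((norm (?d x))\<^sup>2 + (norm (?w x))\<^sup>2) -
        \<bar>K2 - K3\<bar> * (3 * B\<^sup>2) * (norm (jet \<Omega> v x))\<^sup>2 \<partial>?M)"
    unfolding L2_norm_power2 DC_norm_eq_jet[OF L(6)] using int by simp
  also have "\<dots> \<le> (\<integral>x. jet \<Omega> v x \<bullet> flux_hat K1 K2 K3 (n x) (?c x) (jet \<Omega> v x) \<partial>?M)"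
  proof (rule integral_mono_AE)
    show "integrable ?M (\<lambda>x. min K1 K3 * ((norm (?d x))\<^sup>2 + (norm (?w x))\<^sup>2) -
        \<bar>K2 - K3\<bar> * (3 * B\<^sup>2) * (norm (jet \<Omega> v x))\<^sup>2)"
      using int by simp
    show "integrable ?M (\<lambda>x. jet \<Omega> v x \<bullet> flux_hat K1 K2 K3 (n x) (?c x) (jet \<Omega> v x))"
      by (intro integrable_Linfty[OF \<Omega>] Linfty_intros flux_hat_Linfty L)
    show "AE x in ?M. min K1 K3 * ((norm (?d x))\<^sup>2 + (norm (?w x))\<^sup>2) -
        \<bar>K2 - K3\<bar> * (3 * B\<^sup>2) * (norm (jet \<Omega> v x))\<^sup>2
        \<le> jet \<Omega> v x \<bullet> flux_hat K1 K2 K3 (n x) (?c x) (jet \<Omega> v x)"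
      using B
    proof eventually_elim
      case (elim x)
      define E where "E = (n x \<bullet> ?w x)\<^sup>2 + 2 * ((v x \<bullet> ?w x) * (n x \<bullet> ?c x)) +
        2 * ((n x \<bullet> ?w x) * (v x \<bullet> ?c x)) + (v x \<bullet> ?c x)\<^sup>2"
      have K: "K3 * (1 - K2 / K3) = - (K2 - K3)" using K3 by (simp add: field_simps)
      have "jet \<Omega> v x \<bullet> flux_hat K1 K2 K3 (n x) (?c x) (jet \<Omega> v x) =
          K1 * (?d x * ?d x) + K3 * (?w x \<bullet> ?w x) - (K3 * (1 - K2 / K3)) * (n x \<bullet> ?w x)\<^sup>2 +
          (K2 - K3) * (2 * ((v x \<bullet> ?w x) * (n x \<bullet> ?c x)) +
            2 * ((n x \<bullet> ?w x) * (v x \<bullet> ?c x)) + (v x \<bullet> ?c x)\<^sup>2)"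
        unfolding jet_def flux_hat_inner power2_eq_square by (simp add: algebra_simps)
      also have "\<dots> = K1 * (norm (?d x))\<^sup>2 + K3 * (norm (?w x))\<^sup>2 + (K2 - K3) * E"
        unfolding K E_def power2_norm_eq_inner by (simp add: power2_eq_square algebra_simps)
      finally have flux: "jet \<Omega> v x \<bullet> flux_hat K1 K2 K3 (n x) (?c x) (jet \<Omega> v x) =
          K1 * (norm (?d x))\<^sup>2 + K3 * (norm (?w x))\<^sup>2 + (K2 - K3) * E" .
      have "\<bar>E\<bar> \<le> 3 * B\<^sup>2 * ((norm (v x))\<^sup>2 + (norm (?w x))\<^sup>2)"
        unfolding E_def by (rule frank_terms_bound[OF elim])
      also have "\<dots> \<le> 3 * B\<^sup>2 * (norm (jet \<Omega> v x))\<^sup>2"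
        by (intro mult_left_mono) (auto simp: norm_jet)
      finally have "\<bar>(K2 - K3) * E\<bar> \<le> \<bar>K2 - K3\<bar> * (3 * B\<^sup>2 * (norm (jet \<Omega> v x))\<^sup>2)"
        unfolding abs_mult by (intro mult_left_mono) auto
      moreover have "min K1 K3 * (norm (?d x))\<^sup>2 \<le> K1 * (norm (?d x))\<^sup>2"
        "min K1 K3 * (norm (?w x))\<^sup>2 \<le> K3 * (norm (?w x))\<^sup>2"
        by (intro mult_right_mono; simp)+
      ultimately show ?case unfolding flux distrib_left mult.assoc by linarith
    qed
  qed
  finally show ?thesis by (simp add: a_hat_eq_flux[OF \<Omega> n v v] L2_inner_def)
qed

lemma fe_function_bounded_jets:
  assumes "v \<in> H_div \<Omega> \<inter> H_curl \<Omega>" "fe_function_on \<Omega> \<T> v"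
  shows "v \<in> bounded_jets \<Omega>"
proof -
  have v: "v \<in> H_div_curl \<Omega>" using assms(1) by (simp add: H_div_curl_def)
  have "v \<in> Linfty \<Omega>" "wdiv \<Omega> v \<in> Linfty \<Omega>" "wcurl \<Omega> v \<in> Linfty \<Omega>"
    using assms(2) H_div_curlD[OF v] by (auto simp: Linfty_def fe_function_on_def L2_space_measurable)
  then have "jet \<Omega> v \<in> Linfty \<Omega>" unfolding jet_def[abs_def] by (intro Linfty_Pair)
  with v show ?thesis by (simp add: bounded_jets_def)
qed

theorem theorem3p6:
  fixes \<Omega> :: "(real^3) set"
    and V :: "(real^3 \<Rightarrow> real^3) set"
    and g nk :: "real^3 \<Rightarrow> real^3"
    and \<alpha> \<beta> K1 K3 \<zeta> :: real
  assumes "lipschitz_domain \<Omega>"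
    and "g \<in> H_half \<Omega>"
    and "fe_space \<Omega> V" and "V \<subseteq> H_DC0 \<Omega>"
    and "fe_function \<Omega> nk" and "nk \<in> H_DC \<Omega> g"
    and "0 < \<alpha>" and "\<alpha> \<le> 1" and "1 \<le> \<beta>"
    and "\<forall>x\<in>\<Omega>. \<alpha> \<le> (norm (nk x))\<^sup>2 \<and> (norm (nk x))\<^sup>2 \<le> \<beta>"
    and "K1 \<ge> 0" and "K3 > 0" and "\<zeta> > 0"
  shows
    "(\<forall>K2 \<alpha>\<^sub>0. K2 > 0 \<and> K2 / K3 = 1 \<and> \<alpha>\<^sub>0 > 0 \<and>
        (\<forall>v\<in>V. \<alpha>\<^sub>0 * (DC_norm \<Omega> v)\<^sup>2 \<le> a_hat \<Omega> K1 K2 K3 nk v v) \<and>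
        2 * \<zeta> * \<bar>\<alpha> - 1\<bar> < \<alpha>\<^sub>0 \<longrightarrow>
        well_posed \<Omega> V (a_form \<Omega> K1 K2 K3 \<zeta> nk) (F_form \<Omega> K1 K2 K3 \<zeta> nk))
     \<and>
     (\<forall>C. C > 0 \<and>
        (\<forall>v\<in>H_DC0 \<Omega>.
           (L2_norm \<Omega> v)\<^sup>2 \<le> C * ((L2_norm \<Omega> (wdiv \<Omega> v))\<^sup>2 + (L2_norm \<Omega> (wcurl \<Omega> v))\<^sup>2)) \<and>
        min K1 K3 / (C + 1) - 2 * \<zeta> * \<bar>\<alpha> - 1\<bar> > 0 \<longrightarrow>
        (\<exists>\<epsilon>\<^sub>1 \<epsilon>\<^sub>2. \<epsilon>\<^sub>1 > 0 \<and> \<epsilon>\<^sub>2 > 0 \<and>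
           (\<forall>K2. K2 > 0 \<and> K2 / K3 \<in> {1 - \<epsilon>\<^sub>2 <..< 1 + \<epsilon>\<^sub>1} \<and>
              uniformly_spd \<Omega> (\<lambda>x. Z_mat (K2 / K3) (nk x)) \<longrightarrow>
              well_posed \<Omega> V (a_form \<Omega> K1 K2 K3 \<zeta> nk) (F_form \<Omega> K1 K2 K3 \<zeta> nk))))"
proof -
  have \<Omega>: "open \<Omega>" "bounded \<Omega>" using assms(1) by (auto simp: lipschitz_domain_def)
  have n: "nk \<in> bounded_jets \<Omega>"
    using assms(5,6) by (auto simp: fe_function_def H_DC_def intro: fe_function_bounded_jets)
  have V: "finite_dim_space V" "V \<subseteq> bounded_jets \<Omega>"
    using assms(3,4) by (auto simp: fe_space_def H_DC0_def H_DC_def intro: fe_function_bounded_jets)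
  have a_ge: "a_hat \<Omega> K1 K2 K3 nk v v - 2 * \<zeta> * \<bar>\<alpha> - 1\<bar> * (DC_norm \<Omega> v)\<^sup>2 \<le>
      a_form \<Omega> K1 K2 K3 \<zeta> nk v v" if "v \<in> V" for K2 v
    using V(2) that assms(8,10,13) by (intro a_form_ge_a_hat[OF \<Omega> n]) auto
  have part1: "well_posed \<Omega> V (a_form \<Omega> K1 K2 K3 \<zeta> nk) (F_form \<Omega> K1 K2 K3 \<zeta> nk)"
    if \<alpha>\<^sub>0: "\<And>v. v \<in> V \<Longrightarrow> \<alpha>\<^sub>0 * (DC_norm \<Omega> v)\<^sup>2 \<le> a_hat \<Omega> K1 K2 K3 nk v v" "2 * \<zeta> * \<bar>\<alpha> - 1\<bar> < \<alpha>\<^sub>0"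
    for K2 \<alpha>\<^sub>0
  proof (rule linearised_problem_well_posed[OF \<Omega> V n])
    show "0 < \<alpha>\<^sub>0 - 2 * \<zeta> * \<bar>\<alpha> - 1\<bar>" using \<alpha>\<^sub>0(2) by simp
    show "(\<alpha>\<^sub>0 - 2 * \<zeta> * \<bar>\<alpha> - 1\<bar>) * (DC_norm \<Omega> v)\<^sup>2 \<le> a_form \<Omega> K1 K2 K3 \<zeta> nk v v"
      if "v \<in> V" for v
      using \<alpha>\<^sub>0(1)[OF that] a_ge[OF that, of K2] unfolding left_diff_distrib by linarith
  qed
  obtain B\<^sub>1 where B\<^sub>1: "AE x in lebesgue_on \<Omega>. norm (nk x) \<le> B\<^sub>1"
    using bounded_jetsD(3)[OF n] by (rule LinftyE)
  obtain B\<^sub>2 where B\<^sub>2: "AE x in lebesgue_on \<Omega>. norm (wcurl \<Omega> nk x) \<le> B\<^sub>2"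
    using bounded_jetsD(5)[OF n] by (rule LinftyE)
  \<comment> \<open>\<open>B\<close> does not depend on \<open>K\<^sub>2\<close>, hence neither does the neighbourhood of \<open>\<kappa> = 1\<close>.\<close>
  define B where "B = max B\<^sub>1 B\<^sub>2"
  have B: "AE x in lebesgue_on \<Omega>. norm (nk x) \<le> B" "AE x in lebesgue_on \<Omega>. norm (wcurl \<Omega> nk x) \<le> B"
    by (rule eventually_mono[OF B\<^sub>1], simp add: B_def) (rule eventually_mono[OF B\<^sub>2], simp add: B_def)
  have part2: "\<exists>\<epsilon>>0. \<forall>K2. \<bar>K2 / K3 - 1\<bar> < \<epsilon> \<longrightarrow>
      well_posed \<Omega> V (a_form \<Omega> K1 K2 K3 \<zeta> nk) (F_form \<Omega> K1 K2 K3 \<zeta> nk)"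
    if C: "C > 0" "\<And>v. v \<in> H_DC0 \<Omega> \<Longrightarrow>
        (L2_norm \<Omega> v)\<^sup>2 \<le> C * ((L2_norm \<Omega> (wdiv \<Omega> v))\<^sup>2 + (L2_norm \<Omega> (wcurl \<Omega> v))\<^sup>2)"
      and \<beta>\<^sub>1: "min K1 K3 / (C + 1) - 2 * \<zeta> * \<bar>\<alpha> - 1\<bar> > 0" for C
  proof -
    \<comment> \<open>Chosen so that \<open>\<bar>K\<^sub>2 - K\<^sub>3\<bar> * (3 * B\<^sup>2)\<close> stays below \<open>\<beta>\<^sub>1\<close>; adding \<open>1\<close> covers \<open>B = 0\<close>.\<close>
    define \<epsilon> where "\<epsilon> = (min K1 K3 / (C + 1) - 2 * \<zeta> * \<bar>\<alpha> - 1\<bar>) / (K3 * (3 * B\<^sup>2 + 1))"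
    have pos: "K3 * (3 * B\<^sup>2 + 1) > 0" using assms(12) by (simp add: add_nonneg_pos)
    have "\<epsilon> > 0" using \<beta>\<^sub>1 pos by (simp add: \<epsilon>_def)
    moreover have "well_posed \<Omega> V (a_form \<Omega> K1 K2 K3 \<zeta> nk) (F_form \<Omega> K1 K2 K3 \<zeta> nk)"
      if K2: "\<bar>K2 / K3 - 1\<bar> < \<epsilon>" for K2
    proof (rule part1)
      let ?\<delta> = "\<bar>K2 - K3\<bar> * (3 * B\<^sup>2)"
      have "\<bar>K2 - K3\<bar> = K3 * \<bar>K2 / K3 - 1\<bar>" using assms(12) by (simp add: abs_if field_simps)
      then have "?\<delta> = \<bar>K2 / K3 - 1\<bar> * (K3 * (3 * B\<^sup>2))" by simp
      also have "\<dots> \<le> \<bar>K2 / K3 - 1\<bar> * (K3 * (3 * B\<^sup>2 + 1))"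
        using assms(12) by (intro mult_left_mono) auto
      also have "\<dots> < \<epsilon> * (K3 * (3 * B\<^sup>2 + 1))" using K2 pos by (rule mult_strict_right_mono)
      also have "\<dots> = min K1 K3 / (C + 1) - 2 * \<zeta> * \<bar>\<alpha> - 1\<bar>" unfolding \<epsilon>_def times_divide_eq_left
        by (rule nonzero_mult_div_cancel_right[OF less_imp_neq[OF pos, symmetric]])
      finally show "2 * \<zeta> * \<bar>\<alpha> - 1\<bar> < min K1 K3 / (C + 1) - ?\<delta>" by simp
      fix v assume v: "v \<in> V"
      let ?D = "(L2_norm \<Omega> (wdiv \<Omega> v))\<^sup>2 + (L2_norm \<Omega> (wcurl \<Omega> v))\<^sup>2"
      have "(DC_norm \<Omega> v)\<^sup>2 \<le> (C + 1) * ?D"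
        using C(2)[of v] v assms(4) by (auto simp: DC_norm_power2 algebra_simps)
      then have "min K1 K3 / (C + 1) * (DC_norm \<Omega> v)\<^sup>2 \<le> min K1 K3 / (C + 1) * ((C + 1) * ?D)"
        using C(1) assms(11,12) by (intro mult_left_mono) auto
      also have "\<dots> = min K1 K3 * ?D" using C(1) by simp
      finally have "min K1 K3 / (C + 1) * (DC_norm \<Omega> v)\<^sup>2 \<le> min K1 K3 * ?D" .
      with a_hat_lower_bound[OF \<Omega> n _ B assms(12), of v K1 K2] v V(2)
      show "(min K1 K3 / (C + 1) - ?\<delta>) * (DC_norm \<Omega> v)\<^sup>2 \<le> a_hat \<Omega> K1 K2 K3 nk v v"
        unfolding left_diff_distrib by auto
    qed
    ultimately show ?thesis by blast
  qed
  show ?thesis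
  proof (intro conjI allI impI; elim conjE)
    fix K2 \<alpha>\<^sub>0
    assume "\<forall>v\<in>V. \<alpha>\<^sub>0 * (DC_norm \<Omega> v)\<^sup>2 \<le> a_hat \<Omega> K1 K2 K3 nk v v" "2 * \<zeta> * \<bar>\<alpha> - 1\<bar> < \<alpha>\<^sub>0"
    then show "well_posed \<Omega> V (a_form \<Omega> K1 K2 K3 \<zeta> nk) (F_form \<Omega> K1 K2 K3 \<zeta> nk)"
      by (intro part1) auto
  next
    fix C :: real
    assume "C > 0" "\<forall>v\<in>H_DC0 \<Omega>. (L2_norm \<Omega> v)\<^sup>2 \<le>
        C * ((L2_norm \<Omega> (wdiv \<Omega> v))\<^sup>2 + (L2_norm \<Omega> (wcurl \<Omega> v))\<^sup>2)"
      "min K1 K3 / (C + 1) - 2 * \<zeta> * \<bar>\<alpha> - 1\<bar> > 0"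
    from part2[OF this(1) this(2)[rule_format] this(3)] obtain \<epsilon> where "\<epsilon> > 0"
      and \<epsilon>: "\<And>K2. \<bar>K2 / K3 - 1\<bar> < \<epsilon> \<Longrightarrow>
        well_posed \<Omega> V (a_form \<Omega> K1 K2 K3 \<zeta> nk) (F_form \<Omega> K1 K2 K3 \<zeta> nk)" by blast
    \<comment> \<open>The neighbourhood is symmetric: \<open>\<epsilon>\<^sub>1 = \<epsilon>\<^sub>2 = \<epsilon>\<close>.\<close>
    have near_1: "\<bar>r - 1\<bar> < \<epsilon>" if "r \<in> {1 - \<epsilon> <..< 1 + \<epsilon>}" for r
      using that by (auto simp: abs_less_iff)
    from \<open>\<epsilon> > 0\<close> \<epsilon> near_1 show "\<exists>\<epsilon>\<^sub>1 \<epsilon>\<^sub>2. \<epsilon>\<^sub>1 > 0 \<and> \<epsilon>\<^sub>2 > 0 \<and>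
        (\<forall>K2. K2 > 0 \<and> K2 / K3 \<in> {1 - \<epsilon>\<^sub>2 <..< 1 + \<epsilon>\<^sub>1} \<and>
          uniformly_spd \<Omega> (\<lambda>x. Z_mat (K2 / K3) (nk x)) \<longrightarrow>
          well_posed \<Omega> V (a_form \<Omega> K1 K2 K3 \<zeta> nk) (F_form \<Omega> K1 K2 K3 \<zeta> nk))"
      by blast
  qed
qed

end
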